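(* Let $H>0$ and $S_H=\{z\in\mathbb{C}:\,|\operatorname{Im} z|\le H\}$. Let $\mu$ be a measure with support in $S_H$ which is either (a) positive and satisfies $\mu(\{z\in S_H:\,|\operatorname{Re} z|\le r\})\le C_0\max\{1,r^\rho\}$ for all $r>0$ with some positive constants $C_0,\rho$, or (b) a complex measure that is translation bounded on $S_H$, i.e. $\sup_{s\in\mathbb{R}}|\mu|(\{z\in S_H:\,s\le\operatorname{Re} z\le s+1\})<\infty$. Suppose that the c-Fourier transform of $\mu$ is a pure point measure $\hat\mu^c=\sum_{\gamma\in\Gamma}b_\gamma\delta_\gamma$, and that there exists $\eta>0$ such that for every $t\in\mathbb{R}$ the set $\Gamma\cap(t-\eta,t+\eta)$ is linearly independent over $\mathbb{Z}$. Then $$|\hat\mu^c|(t-1,t+1)=O(e^{2\pi H|t|})\quad\text{as } t\to\infty,$$ and $\hat\mu^c$ has type at most $2\pi H$ with respect to exponential growth, i.e. $\limsup_{r\to\infty}r^{-1}\log|\hat\mu^c|(-r,r)\le 2\pi H$.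
   Context: $|\sigma|$ denotes the variation of a complex measure $\sigma$. For $\varphi\in L^1(\mathbb{R})$ with compact support, $\hat\varphi^c(z)=\int_{\mathbb{R}}\varphi(t)e^{-2\pi i z t}\,dt$, $z\in\mathbb{C}$. Let $\mathcal{D}$ be the space of $C^\infty$ compactly supported functions on $\mathbb{R}$. For a measure $\mu$ on $S_H$ with $|\mu|(\{z\in S_H:|\operatorname{Re} z|\le r\})\le C\max\{1,r^\rho\}$ (which holds for translation bounded measures with $\rho=1$), the c-Fourier transform $\hat\mu^c$ is the functional on $\mathcal{D}$ given by $(\hat\mu^c,\varphi)=\int_{S_H}\hat\varphi^c(z)\,\mu(dz)$. "$\hat\mu^c$ is a pure point measure $\sum_{\gamma\in\Gamma}b_\gamma\delta_\gamma$" means $\Gamma\subset\mathbb{R}$ is countable, $b_\gamma\in\mathbb{C}$, $\sum_{\gamma\in\Gamma\cap K}|b_\gamma|<\infty$ for every compact $K$, and $(\hat\mu^c,\varphi)=\sum_\gamma b_\gamma\varphi(\gamma)$ for all $\varphi\in\mathcal{D}$; $\delta_\gamma$ is the unit mass at $\gamma$. A set $X\subset\mathbb{R}$ is linearly independent over $\mathbb{Z}$ if for any distinct $t_1,\dots,t_n\in X$ and $m_1,\dots,m_n\in\mathbb{Z}$, $m_1t_1+\dots+m_nt_n=0$ implies $m_1=\dots=m_n=0$. *)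

theory Defs
  imports "HOL-Analysis.Analysis" "HOL-Library.Landau_Symbols"
begin

definition strip :: "real \<Rightarrow> complex set" where
  "strip H = {z. \<bar>Im z\<bar> \<le> H}"

definition test_fun :: "(real \<Rightarrow> complex) \<Rightarrow> bool" where
  "test_fun \<phi> \<longleftrightarrow>
     (\<exists>D :: nat \<Rightarrow> real \<Rightarrow> complex. D 0 = \<phi> \<and>
        (\<forall>n x. (D n has_vector_derivative D (Suc n) x) (at x))) \<and>
     compact (closure {t. \<phi> t \<noteq> 0})"

definition cfourier :: "(real \<Rightarrow> complex) \<Rightarrow> complex \<Rightarrow> complex" where
  "cfourier \<phi> z = (LINT t|lborel. \<phi> t * exp (- (2 * pi * \<i>) * z * complex_of_real t))"

text \<open>A complex measure \<mu> on the complex plane is represented by its polar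
  decomposition: its variation |\<mu>| = \<nu> (a positive Borel measure) and a
  density f with |f| = 1 \<nu>-a.e., so that \<mu>(dz) = f(z) \<nu>(dz).
  The c-Fourier transform of \<mu> applied to a test function \<phi>:\<close>
definition cFT_meas :: "complex measure \<Rightarrow> (complex \<Rightarrow> complex) \<Rightarrow> (real \<Rightarrow> complex) \<Rightarrow> complex" where
  "cFT_meas \<nu> f \<phi> = (LINT z|\<nu>. cfourier \<phi> z * f z)"

definition lin_indep_int :: "real set \<Rightarrow> bool" where
  "lin_indep_int X \<longleftrightarrow>
     (\<forall>F (m :: real \<Rightarrow> int). finite F \<and> F \<subseteq> X \<and> (\<Sum>t\<in>F. of_int (m t) * t) = 0
        \<longrightarrow> (\<forall>t\<in>F. m t = 0))"

definition cFT_pure_point ::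
  "complex measure \<Rightarrow> (complex \<Rightarrow> complex) \<Rightarrow> real set \<Rightarrow> (real \<Rightarrow> complex) \<Rightarrow> bool" where
  "cFT_pure_point \<nu> f \<Gamma> b \<longleftrightarrow>
     countable \<Gamma> \<and>
     (\<forall>K. compact K \<longrightarrow> (\<lambda>\<gamma>. norm (b \<gamma>)) summable_on (\<Gamma> \<inter> K)) \<and>
     (\<forall>\<phi>. test_fun \<phi> \<longrightarrow> cFT_meas \<nu> f \<phi> = (\<Sum>\<^sub>\<infinity>\<gamma>\<in>\<Gamma>. b \<gamma> * \<phi> \<gamma>))"

definition pp_var :: "real set \<Rightarrow> (real \<Rightarrow> complex) \<Rightarrow> real set \<Rightarrow> real" where
  "pp_var \<Gamma> b A = (\<Sum>\<^sub>\<infinity>\<gamma>\<in>\<Gamma> \<inter> A. norm (b \<gamma>))"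

end

(*
Test the identity between the measure and its c-Fourier transform against
phi(x - t) exp(-2 pi i s x), where phi is a smooth bump supported in (-eta, eta).  On the transform
side this gives the absolutely convergent series sum_g b_g phi(g - t) exp(-2 pi i s g); on the
measure side it is bounded by C exp(2 pi H |t|) uniformly in s, because the transform of phi decays
fast on the strip and mu is translation bounded.  The frequencies involved are independent over Z,
so by Kronecker's theorem the supremum over s of the modulus of the series is
sum_g |b_g| phi(g - t).

A positive measure of polynomial growth is translation bounded for the following reason.  Let psi be
chi * chi with chi an even real bump, so that its transform is nonnegative on the real axis; off the
axis its real part is at least minus a rapidly decaying multiple of |Im z|.  Rescaled to width L,
the transform of psi has real part at least c on a window of length 2L, up to an error on the strip
that is O(1/L) times a rapidly decaying weight.  Hence the masses h(s) of the windows satisfy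
h(s) <= A + V(s) / 2 for every majorant V of h of polynomial growth once L is large, and iterating
this inequality from the polynomial a priori bound gives h <= 2A.
*)
theory Submission
  imports Defs "HOL-Real_Asymp.Real_Asymp"
begin

section \<open>Smooth functions of a real variable\<close>

coinductive smooth_fun :: "(real \<Rightarrow> 'a::real_normed_vector) \<Rightarrow> bool" where
  "\<forall>x. (g has_vector_derivative g' x) (at x) \<Longrightarrow> smooth_fun g' \<Longrightarrow> smooth_fun g"

lemma smooth_fun_has_derivativeE:
  assumes "smooth_fun g"
  obtains g' where "\<forall>x. (g has_vector_derivative g' x) (at x)" "smooth_fun g'"
  using assms by cases

lemma smooth_fun_iff_derivative_sequence:
  "smooth_fun g \<longleftrightarrow>
    (\<exists>D :: nat \<Rightarrow> real \<Rightarrow> 'a::real_normed_vector.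
      D 0 = g \<and> (\<forall>n x. (D n has_vector_derivative D (Suc n) x) (at x)))"
proof
  assume g: "smooth_fun g"
  have "\<exists>h'. smooth_fun h' \<and> (\<forall>x. (h has_vector_derivative h' x) (at x))"
    if "smooth_fun h" for h :: "real \<Rightarrow> 'a"
    using that by cases blast
  then obtain d :: "(real \<Rightarrow> 'a) \<Rightarrow> real \<Rightarrow> 'a" where d:
    "\<And>h. smooth_fun h \<Longrightarrow> smooth_fun (d h) \<and> (\<forall>x. (h has_vector_derivative d h x) (at x))"
    by metis
  have "smooth_fun ((d ^^ n) g)" for n
    by (induction n) (use g d in auto)
  then show "\<exists>D. D 0 = g \<and> (\<forall>n x. (D n has_vector_derivative D (Suc n) x) (at x))"
    using d by (intro exI[of _ "\<lambda>n. (d ^^ n) g"]) auto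
next
  assume "\<exists>D :: nat \<Rightarrow> real \<Rightarrow> 'a.
    D 0 = g \<and> (\<forall>n x. (D n has_vector_derivative D (Suc n) x) (at x))"
  then show "smooth_fun g"
  proof (coinduction arbitrary: g)
    case smooth_fun
    then obtain D where D: "D 0 = g" "\<And>n x. (D n has_vector_derivative D (Suc n) x) (at x)"
      by blast
    then have "\<exists>D'. D' 0 = D 1 \<and> (\<forall>n x. (D' n has_vector_derivative D' (Suc n) x) (at x))"
      by (intro exI[of _ "\<lambda>n. D (Suc n)"]) auto
    then show ?case
      using D(1) D(2)[of 0] by (intro exI[of _ g] exI[of _ "D 1"]) auto
  qed
qed

lemma smooth_fun_derivative:
  assumes "smooth_fun g" "\<forall>x. (g has_vector_derivative g' x) (at x)"
  shows "smooth_fun g'"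
proof -
  obtain h where h: "\<forall>x. (g has_vector_derivative h x) (at x)" "smooth_fun h"
    using assms(1) by (rule smooth_fun_has_derivativeE)
  have "g' x = h x" for x
    using assms(2) h(1) by (blast intro: vector_derivative_unique_at)
  then have "g' = h" ..
  then show ?thesis
    using h(2) by simp
qed

lemma smooth_fun_continuous_on: "smooth_fun g \<Longrightarrow> continuous_on A g"
  by (metis continuous_at_imp_continuous_on has_vector_derivative_continuous
      smooth_fun_has_derivativeE)

lemma smooth_fun_bounded_linear:
  assumes "bounded_linear T" "smooth_fun g"
  shows "smooth_fun (\<lambda>x. T (g x))"
  using assms(2)
proof (coinduction arbitrary: g)
  case smooth_fun
  then obtain g' where "\<forall>x. (g has_vector_derivative g' x) (at x)" "smooth_fun g'"
    by (rule smooth_fun_has_derivativeE)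
  then show ?case
    using bounded_linear.has_vector_derivative[OF assms(1)]
    by (intro exI[of _ "\<lambda>x. T (g x)"] exI[of _ "\<lambda>x. T (g' x)"]) auto
qed

text \<open>The derivative of a product is a sum of products, so the coinduction runs over these.\<close>

inductive sum_of_smooth_products :: "(real \<Rightarrow> 'a::real_normed_algebra) \<Rightarrow> bool" where
  product: "smooth_fun g \<Longrightarrow> smooth_fun h \<Longrightarrow> sum_of_smooth_products (\<lambda>x. g x * h x)"
| add: "sum_of_smooth_products g \<Longrightarrow> sum_of_smooth_products h
    \<Longrightarrow> sum_of_smooth_products (\<lambda>x. g x + h x)"

lemma sum_of_smooth_products_has_derivative:
  assumes "sum_of_smooth_products k"
  shows "\<exists>k'. (\<forall>x. (k has_vector_derivative k' x) (at x)) \<and> sum_of_smooth_products k'"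
  using assms
proof induction
  case (product g h)
  obtain g' where "\<forall>x. (g has_vector_derivative g' x) (at x)" "smooth_fun g'"
    using product(1) by (rule smooth_fun_has_derivativeE)
  moreover obtain h' where "\<forall>x. (h has_vector_derivative h' x) (at x)" "smooth_fun h'"
    using product(2) by (rule smooth_fun_has_derivativeE)
  ultimately show ?case
    using product by (intro exI[of _ "\<lambda>x. g x * h' x + g' x * h x"])
      (auto intro!: sum_of_smooth_products.intros has_vector_derivative_mult)
next
  case (add g h)
  then obtain g' h' where
    "\<forall>x. (g has_vector_derivative g' x) (at x)" "sum_of_smooth_products g'"
    "\<forall>x. (h has_vector_derivative h' x) (at x)" "sum_of_smooth_products h'"
    by blast
  then show ?case
    by (intro exI[of _ "\<lambda>x. g' x + h' x"])
      (auto intro!: sum_of_smooth_products.intros has_vector_derivative_add)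
qed

lemma smooth_fun_mult:
  fixes g h :: "real \<Rightarrow> 'a::real_normed_algebra"
  assumes "smooth_fun g" "smooth_fun h"
  shows "smooth_fun (\<lambda>x. g x * h x)"
proof -
  have "sum_of_smooth_products (\<lambda>x. g x * h x)"
    using assms by (rule sum_of_smooth_products.product)
  then show ?thesis
  proof (rule smooth_fun.coinduct)
    fix k :: "real \<Rightarrow> 'a"
    assume "sum_of_smooth_products k"
    then show "\<exists>g g'. k = g \<and> (\<forall>x. (g has_vector_derivative g' x) (at x)) \<and>
        (sum_of_smooth_products g' \<or> smooth_fun g')"
      using sum_of_smooth_products_has_derivative by blast
  qed
qed

lemma has_vector_derivative_affine_compose:
  assumes "\<forall>x. (g has_vector_derivative g' x) (at x)"
  shows "((\<lambda>x. g (a * x + b)) has_vector_derivative a *\<^sub>R g' (a * x + b)) (at x)"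
proof -
  have "((\<lambda>x. a * x + b) has_vector_derivative a) (at x)"
    unfolding has_real_derivative_iff_has_vector_derivative[symmetric]
    by (auto intro!: derivative_eq_intros)
  from vector_diff_chain_at[OF this assms[rule_format]] show ?thesis
    by (simp add: o_def)
qed

lemma smooth_fun_affine_compose:
  assumes "smooth_fun g"
  shows "smooth_fun (\<lambda>x. g (a * x + b))"
  using assms
proof (coinduction arbitrary: g)
  case smooth_fun
  then obtain g' where g': "\<forall>x. (g has_vector_derivative g' x) (at x)" "smooth_fun g'"
    by (rule smooth_fun_has_derivativeE)
  then have "smooth_fun (\<lambda>x. a *\<^sub>R g' x)"
    by (intro smooth_fun_bounded_linear[OF bounded_linear_scaleR_right])
  then show ?case
    using has_vector_derivative_affine_compose[OF g'(1), of a b]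
    by (intro exI[of _ "\<lambda>x. g (a * x + b)"] exI[of _ "\<lambda>x. a *\<^sub>R g' (a * x + b)"])
      (auto intro!: exI[of _ "\<lambda>x. a *\<^sub>R g' x"])
qed

lemma has_vector_derivative_exp_mult_of_real:
  fixes a :: "'a::{real_normed_field, banach}"
  shows "((\<lambda>x. exp (a * of_real x)) has_vector_derivative a * exp (a * of_real x)) (at x)"
  by (rule derivative_eq_intros has_vector_derivative_real_field | simp)+

lemma smooth_fun_exp_mult_of_real:
  fixes a :: "'a::{real_normed_field, banach}"
  shows "smooth_fun (\<lambda>x. exp (a * of_real x))"
proof -
  have "smooth_fun (\<lambda>x. c * exp (a * of_real x))" for c
  proof (coinduction arbitrary: c)
    case smooth_fun
    have "((\<lambda>x. c * exp (a * of_real x)) has_vector_derivative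
        (c * a) * exp (a * of_real x)) (at x)" for x
      unfolding mult.assoc
      by (intro has_vector_derivative_mult_right has_vector_derivative_exp_mult_of_real)
    then show ?case
      by (intro exI[of _ "\<lambda>x. c * exp (a * of_real x)"]
          exI[of _ "\<lambda>x. (c * a) * exp (a * of_real x)"]) auto
  qed
  from this[of 1] show ?thesis by simp
qed

definition flat_fun :: "real poly \<Rightarrow> real \<Rightarrow> real" where
  "flat_fun p x = (if x > 0 then poly p (1 / x) * exp (- 1 / x) else 0)"

lemma tendsto_poly_mult_exp_minus: "((\<lambda>x. poly p x * exp (- x)) \<longlongrightarrow> 0) at_top"
  for p :: "real poly"
proof -
  have "((\<lambda>x. \<Sum>i\<le>degree p. coeff p i * (x ^ i / exp x)) \<longlongrightarrow>
      (\<Sum>i\<le>degree p. coeff p i * 0)) at_top"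
    by (intro tendsto_sum tendsto_mult tendsto_const tendsto_power_div_exp_0)
  then show ?thesis
    by (simp add: poly_altdef sum_distrib_right sum_divide_distrib exp_minus field_simps)
qed

lemma flat_fun_div_tendsto_0: "((\<lambda>y. flat_fun p y / y) \<longlongrightarrow> 0) (at 0)"
proof (rule filterlim_split_at)
  have "((\<lambda>y. poly ([:0, 1:] * p) (inverse y) * exp (- inverse y)) \<longlongrightarrow> 0) (at_right 0)"
    using tendsto_poly_mult_exp_minus filterlim_inverse_at_top_right by (rule filterlim_compose)
  moreover have "\<forall>\<^sub>F y in at_right 0.
      poly ([:0, 1:] * p) (inverse y) * exp (- inverse y) = flat_fun p y / y"
    by (auto simp: flat_fun_def field_simps eventually_at_filter)
  ultimately show "((\<lambda>y. flat_fun p y / y) \<longlongrightarrow> 0) (at_right 0)"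
    by (rule Lim_transform_eventually)
  have "\<forall>\<^sub>F y in at_left 0. 0 = flat_fun p y / y"
    by (auto simp: flat_fun_def eventually_at_filter)
  then show "((\<lambda>y. flat_fun p y / y) \<longlongrightarrow> 0) (at_left 0)"
    by (rule Lim_transform_eventually[OF tendsto_const])
qed

lemma flat_fun_has_real_derivative:
  "(flat_fun p has_real_derivative flat_fun ([:0, 0, 1:] * (p - pderiv p)) x) (at x)"
proof -
  consider "x > 0" | "x < 0" | "x = 0" by linarith
  then show ?thesis
  proof cases
    assume x: "x > 0"
    have "((\<lambda>x. poly p (1 / x) * exp (- 1 / x)) has_real_derivative
        flat_fun ([:0, 0, 1:] * (p - pderiv p)) x) (at x)"
      using x by (auto intro!: derivative_eq_intros poly_DERIV[THEN DERIV_chain2]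
          simp: flat_fun_def power2_eq_square field_simps)
    moreover have "\<forall>\<^sub>F y in nhds x. poly p (1 / y) * exp (- 1 / y) = flat_fun p y"
      using eventually_nhds_in_open[of "{0<..}" x] x
      by (auto elim!: eventually_mono simp: flat_fun_def)
    ultimately show ?thesis
      by (rule DERIV_cong_ev[OF refl _ refl, THEN iffD1, rotated])
  next
    assume x: "x < 0"
    have "((\<lambda>x. 0) has_real_derivative flat_fun ([:0, 0, 1:] * (p - pderiv p)) x) (at x)"
      using x by (simp add: flat_fun_def)
    moreover have "\<forall>\<^sub>F y in nhds x. 0 = flat_fun p y"
      using eventually_nhds_in_open[of "{..<0}" x] x
      by (auto elim!: eventually_mono simp: flat_fun_def)
    ultimately show ?thesis
      by (rule DERIV_cong_ev[OF refl _ refl, THEN iffD1, rotated])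
  next
    assume "x = 0"
    then show ?thesis
      using flat_fun_div_tendsto_0[of p] by (simp add: has_field_derivative_iff flat_fun_def)
  qed
qed

lemma smooth_fun_flat_fun: "smooth_fun (flat_fun p)"
proof (coinduction arbitrary: p)
  case smooth_fun
  show ?case
    using flat_fun_has_real_derivative[of p]
    unfolding has_real_derivative_iff_has_vector_derivative
    by (intro exI[of _ "flat_fun p"] exI[of _ "flat_fun ([:0, 0, 1:] * (p - pderiv p))"]) auto
qed

definition bump :: "real \<Rightarrow> real \<Rightarrow> real" where
  "bump r x = flat_fun 1 (r + x) * flat_fun 1 (r - x)"

lemma smooth_fun_bump: "smooth_fun (bump r)"
proof -
  have "smooth_fun (\<lambda>x. flat_fun 1 (1 * x + r) * flat_fun 1 (- 1 * x + r))"
    by (intro smooth_fun_mult smooth_fun_affine_compose smooth_fun_flat_fun)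
  then show ?thesis
    by (simp add: bump_def[abs_def] add.commute)
qed

lemma bump_nonneg: "bump r x \<ge> 0"
  by (simp add: bump_def flat_fun_def)

lemma bump_eq_0: "\<bar>x\<bar> \<ge> r \<Longrightarrow> bump r x = 0"
  by (auto simp: bump_def flat_fun_def)

lemma bump_minus [simp]: "bump r (- x) = bump r x"
  by (simp add: bump_def)

lemma bump_ge:
  assumes "r > 0" "\<bar>x\<bar> \<le> r / 2"
  shows "bump r x \<ge> exp (- 4 / r)"
proof -
  have "exp (- 2 / r) \<le> flat_fun 1 y" if "y \<ge> r / 2" for y
  proof -
    have "1 / y \<le> 1 / (r / 2)" using assms that by (intro divide_left_mono) auto
    then show ?thesis using assms that by (auto simp: flat_fun_def)
  qed
  then have "exp (- 2 / r) * exp (- 2 / r) \<le> bump r x"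
    unfolding bump_def using assms by (intro mult_mono) (auto simp: flat_fun_def)
  then show ?thesis by (simp flip: exp_add)
qed

section \<open>Test functions\<close>

lemma test_fun_iff: "test_fun g \<longleftrightarrow> smooth_fun g \<and> compact (closure {t. g t \<noteq> 0})"
  by (simp add: test_fun_def smooth_fun_iff_derivative_sequence)

lemma test_funI:
  assumes "smooth_fun g" "\<And>x. \<bar>x\<bar> > R \<Longrightarrow> g x = 0"
  shows "test_fun g"
proof -
  have "{t. g t \<noteq> 0} \<subseteq> {-R..R}"
    using assms(2) by force
  then show ?thesis
    unfolding test_fun_iff
    using assms(1) bounded_subset[OF bounded_closed_interval] compact_closure by blast
qed

lemma test_fun_supportE:
  assumes "test_fun g"
  obtains R where "R > 0" "\<And>x. \<bar>x\<bar> \<ge> R \<Longrightarrow> g x = 0"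
proof -
  have "bounded {t. g t \<noteq> 0}"
    using assms unfolding test_fun_iff
    using compact_imp_bounded bounded_subset closure_subset by metis
  then obtain B where "\<forall>x\<in>{t. g t \<noteq> 0}. norm x \<le> B" "B > 0"
    unfolding bounded_pos by blast
  then show thesis
    by (intro that[of "B + 1"]) force+
qed

lemma test_fun_smooth_fun: "test_fun g \<Longrightarrow> smooth_fun g"
  by (simp add: test_fun_iff)

lemma test_fun_continuous_on: "test_fun g \<Longrightarrow> continuous_on A g"
  by (simp add: test_fun_smooth_fun smooth_fun_continuous_on)

lemma test_fun_borel_measurable: "test_fun g \<Longrightarrow> g \<in> borel_measurable borel"
  by (simp add: borel_measurable_continuous_onI test_fun_continuous_on)

lemma test_fun_bump: "test_fun (\<lambda>x. complex_of_real (bump r x))"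
  by (intro test_funI[of _ r] smooth_fun_bounded_linear[OF bounded_linear_of_real] smooth_fun_bump)
    (simp add: bump_eq_0)

lemma test_fun_mult_smooth_fun:
  assumes "test_fun g" "smooth_fun h"
  shows "test_fun (\<lambda>x. g x * h x)"
proof -
  obtain R where "\<And>x. \<bar>x\<bar> \<ge> R \<Longrightarrow> g x = 0"
    using assms(1) by (meson test_fun_supportE)
  then show ?thesis
    using assms by (intro test_funI[of _ R] smooth_fun_mult) (auto simp: test_fun_iff)
qed

lemma test_fun_cmult:
  assumes "test_fun g"
  shows "test_fun (\<lambda>x. c * g x)"
proof -
  obtain R where "\<And>x. \<bar>x\<bar> \<ge> R \<Longrightarrow> g x = 0"
    using assms by (meson test_fun_supportE)
  then show ?thesis
    using assms
    by (intro test_funI[of _ R] smooth_fun_bounded_linear[OF bounded_linear_mult_right])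
      (auto simp: test_fun_iff)
qed

lemma test_fun_affine_compose:
  assumes "test_fun g" "a \<noteq> 0"
  shows "test_fun (\<lambda>x. g (a * x + b))"
proof -
  obtain R where R: "\<And>x. \<bar>x\<bar> \<ge> R \<Longrightarrow> g x = 0"
    using assms(1) by (meson test_fun_supportE)
  have "g (a * x + b) = 0" if "\<bar>x\<bar> > (R + \<bar>b\<bar>) / \<bar>a\<bar>" for x
  proof (rule R)
    have "\<bar>a * x\<bar> > R + \<bar>b\<bar>"
      using that assms(2) by (simp add: abs_mult field_simps)
    then show "\<bar>a * x + b\<bar> \<ge> R" by linarith
  qed
  then show ?thesis
    by (rule test_funI[OF smooth_fun_affine_compose[OF test_fun_smooth_fun[OF assms(1)]]])
qed

lemma test_fun_translate: "test_fun g \<Longrightarrow> test_fun (\<lambda>x. g (x - t))"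
  using test_fun_affine_compose[of g 1 "- t"] by simp

lemma test_fun_derivative:
  assumes "test_fun g" and deriv: "\<forall>x. (g has_vector_derivative g' x) (at x)"
  shows "test_fun g'"
proof -
  obtain R where R: "\<And>x. \<bar>x\<bar> \<ge> R \<Longrightarrow> g x = 0"
    using assms(1) by (meson test_fun_supportE)
  have "g' x = 0" if "\<bar>x\<bar> > R" for x
  proof -
    have "((\<lambda>_. 0) has_vector_derivative 0) (at x)" by simp
    moreover have "open (- {-R..R})" "x \<in> - {-R..R}"
      using that by (auto simp: open_Compl)
    ultimately have "(g has_vector_derivative 0) (at x)"
      by (rule has_vector_derivative_transform_within_open) (use R in force)
    then show ?thesis
      using deriv vector_derivative_unique_at by blast
  qed
  then show ?thesis
    using smooth_fun_derivative[OF test_fun_smooth_fun[OF assms(1)] deriv] by (intro test_funI)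
qed

lemma test_fun_has_derivativeE:
  assumes "test_fun g"
  obtains g' where "\<forall>x. (g has_vector_derivative g' x) (at x)" "test_fun g'"
proof -
  obtain g' where "\<forall>x. (g has_vector_derivative g' x) (at x)"
    using test_fun_smooth_fun[OF assms] by (rule smooth_fun_has_derivativeE)
  then show thesis
    using test_fun_derivative[OF assms] that by blast
qed

lemma integrable_continuous_compact_support:
  fixes g :: "'a::euclidean_space \<Rightarrow> 'b::{banach, second_countable_topology}"
  assumes "continuous_on UNIV g" "compact S" "\<And>x. x \<notin> S \<Longrightarrow> g x = 0"
  shows "integrable lborel g"
proof -
  have "(\<lambda>x. indicator S x *\<^sub>R g x) = g"
    using assms(3) by (auto simp: indicator_def)
  then show ?thesis
    using borel_integrable_compact[of S g] assms continuous_on_subset[of UNIV g S] by auto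
qed

lemma integrable_test_fun_mult:
  assumes "test_fun g" "continuous_on UNIV h"
  shows "integrable lborel (\<lambda>t. g t * h t)"
proof -
  obtain R where R: "\<And>x. \<bar>x\<bar> \<ge> R \<Longrightarrow> g x = 0"
    using assms(1) by (meson test_fun_supportE)
  show ?thesis
  proof (rule integrable_continuous_compact_support[of _ "{-R..R}"])
    show "continuous_on UNIV (\<lambda>t. g t * h t)"
      by (intro continuous_intros test_fun_continuous_on assms)
    show "g x * h x = 0" if "x \<notin> {-R..R}" for x
      using R[of x] that by auto
  qed auto
qed

lemma integrable_test_fun: "test_fun g \<Longrightarrow> integrable lborel g"
  using integrable_test_fun_mult[of g "\<lambda>_. 1"] by simp

lemma norm_LINT_test_fun_mult_le:
  assumes "test_fun g" "continuous_on UNIV h" "\<And>t. g t \<noteq> 0 \<Longrightarrow> norm (h t) \<le> B"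
  shows "norm (LINT t|lborel. g t * h t) \<le> (LINT t|lborel. norm (g t)) * B"
proof -
  have "norm (g t * h t) \<le> norm (g t) * B" for t
    using assms(3)[of t] by (cases "g t = 0") (auto simp: norm_mult intro: mult_left_mono)
  then have "norm (LINT t|lborel. g t * h t) \<le> (LINT t|lborel. norm (g t) * B)"
    using assms
    by (intro Bochner_Integration.integral_norm_bound_integral integrable_test_fun_mult
        integrable_mult_left integrable_norm integrable_test_fun)
  then show ?thesis by simp
qed

lemma LINT_derivative_test_fun_eq_0:
  assumes "test_fun g" and deriv: "\<forall>x. (g has_vector_derivative g' x) (at x)"
  shows "(LINT t|lborel. g' t) = 0"
proof -
  have g': "test_fun g'"
    using assms by (rule test_fun_derivative)
  obtain R where R: "R > 0" "\<And>x. \<bar>x\<bar> \<ge> R \<Longrightarrow> g x = 0"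
    using assms(1) by (meson test_fun_supportE)
  obtain R' where R': "\<And>x. \<bar>x\<bar> \<ge> R' \<Longrightarrow> g' x = 0"
    using g' by (meson test_fun_supportE)
  define Q where "Q = max R R'"
  have "(LINT t|lborel. g' t) = (LINT t|lborel. indicator {-Q..Q} t *\<^sub>R g' t)"
    using R' by (intro Bochner_Integration.integral_cong) (auto simp: indicator_def Q_def)
  also have "\<dots> = g Q - g (- Q)"
  proof (rule integral_FTC_Icc)
    show "(g has_vector_derivative g' x) (at x within {-Q..Q})" for x
      using deriv by (blast intro: has_vector_derivative_at_within)
    show "continuous_on {-Q..Q} g'"
      using g' by (rule test_fun_continuous_on)
  qed (use R(1) in \<open>simp add: Q_def\<close>)
  also have "\<dots> = 0"
    using R(1) by (simp add: R(2) Q_def)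
  finally show ?thesis .
qed

section \<open>The c-Fourier transform of a test function\<close>

definition fourier_kernel :: "complex \<Rightarrow> real \<Rightarrow> complex" where
  "fourier_kernel z t = exp (- (2 * pi * \<i>) * z * complex_of_real t)"

lemma cfourier_eq: "cfourier g z = (LINT t|lborel. g t * fourier_kernel z t)"
  by (simp add: cfourier_def fourier_kernel_def)

lemma fourier_kernel_add_left: "fourier_kernel (w + z) t = fourier_kernel w t * fourier_kernel z t"
  by (simp add: fourier_kernel_def algebra_simps flip: exp_add)

lemma fourier_kernel_add_right: "fourier_kernel z (s + t) = fourier_kernel z s * fourier_kernel z t"
  by (simp add: fourier_kernel_def algebra_simps flip: exp_add)

lemma norm_fourier_kernel: "norm (fourier_kernel z t) = exp (2 * pi * Im z * t)"
  by (simp add: fourier_kernel_def)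

lemma norm_fourier_kernel_of_real [simp]: "norm (fourier_kernel (of_real x) t) = 1"
  by (simp add: norm_fourier_kernel)

lemma fourier_kernel_of_real: "fourier_kernel (of_real x) t = cis (- (2 * pi * x * t))"
  by (simp add: fourier_kernel_def cis_conv_exp algebra_simps)

lemma norm_fourier_kernel_le:
  assumes "z \<in> strip H"
  shows "norm (fourier_kernel z t) \<le> exp (2 * pi * H * \<bar>t\<bar>)"
proof -
  have "Im z * t \<le> \<bar>Im z\<bar> * \<bar>t\<bar>"
    by (metis abs_ge_self abs_mult)
  also have "\<dots> \<le> H * \<bar>t\<bar>"
    using assms by (intro mult_right_mono) (auto simp: strip_def)
  finally show ?thesis
    by (simp add: norm_fourier_kernel mult.assoc)
qed

lemma fourier_kernel_has_vector_derivative: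
  "(fourier_kernel z has_vector_derivative - (2 * pi * \<i>) * z * fourier_kernel z t) (at t)"
  unfolding fourier_kernel_def[abs_def] by (rule has_vector_derivative_exp_mult_of_real)

lemma smooth_fun_fourier_kernel: "smooth_fun (fourier_kernel z)"
  unfolding fourier_kernel_def[abs_def] by (rule smooth_fun_exp_mult_of_real)

lemma continuous_on_fourier_kernel [continuous_intros]: "continuous_on A (fourier_kernel z)"
  using smooth_fun_fourier_kernel by (rule smooth_fun_continuous_on)

lemma norm_fourier_kernel_diff_Re_le:
  "norm (fourier_kernel z t - fourier_kernel (of_real (Re z)) t) \<le>
    2 * pi * \<bar>t\<bar> * exp (2 * pi * \<bar>Im z\<bar> * \<bar>t\<bar>) * \<bar>Im z\<bar>"
proof -
  have "fourier_kernel z t =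
      fourier_kernel (of_real (Re z)) t * fourier_kernel (\<i> * of_real (Im z)) t"
    by (simp flip: fourier_kernel_add_left complex_eq)
  then have "fourier_kernel z t - fourier_kernel (of_real (Re z)) t =
      fourier_kernel (of_real (Re z)) t * (fourier_kernel (\<i> * of_real (Im z)) t - 1)"
    by (simp add: algebra_simps)
  also have "norm \<dots> = norm (exp (complex_of_real (2 * pi * Im z * t)) - 1)"
    by (simp add: norm_mult) (simp add: fourier_kernel_def algebra_simps)
  also have "\<dots> \<le> exp \<bar>2 * pi * Im z * t\<bar> * \<bar>2 * pi * Im z * t\<bar>"
    using Taylor_exp[of "complex_of_real (2 * pi * Im z * t)" 0] by (simp del: of_real_mult)
  finally show ?thesis
    by (simp add: abs_mult mult_ac)
qed

lemma cfourier_borel_measurable: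
  assumes "test_fun g"
  shows "cfourier g \<in> borel_measurable borel"
  unfolding cfourier_def[abs_def] using test_fun_borel_measurable[OF assms] by measurable

lemma cfourier_mult_fourier_kernel:
  "cfourier (\<lambda>t. g t * fourier_kernel w t) z = cfourier g (w + z)"
  by (simp add: cfourier_eq fourier_kernel_add_left mult.assoc)

lemma cfourier_translate:
  "cfourier (\<lambda>t. g (t - \<tau>)) z = fourier_kernel z \<tau> * cfourier g z"
proof -
  have "cfourier (\<lambda>t. g (t - \<tau>)) z = (LINT t|lborel. g t * fourier_kernel z (\<tau> + t))"
    unfolding cfourier_eq by (subst lborel_integral_real_affine[of 1 _ \<tau>]) auto
  also have "\<dots> = (LINT t|lborel. fourier_kernel z \<tau> * (g t * fourier_kernel z t))"
    by (simp add: fourier_kernel_add_right mult_ac)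
  finally show ?thesis
    by (simp add: cfourier_eq)
qed

lemma cfourier_dilate:
  assumes "L > 0"
  shows "cfourier (\<lambda>t. g (L * t)) z = cfourier g (z / of_real L) / of_real L"
proof -
  have "fourier_kernel (z / of_real L) (L * t) = fourier_kernel z t" for t
    using assms by (simp add: fourier_kernel_def mult_ac)
  moreover have "cfourier g (z / of_real L) =
      L *\<^sub>R (LINT t|lborel. g (L * t) * fourier_kernel (z / of_real L) (L * t))"
    unfolding cfourier_eq using assms by (subst lborel_integral_real_affine[of L _ 0]) auto
  ultimately show ?thesis
    using assms by (simp add: cfourier_eq scaleR_conv_of_real)
qed

lemma cfourier_cmult: "cfourier (\<lambda>t. c * g t) z = c * cfourier g z"
  by (simp add: cfourier_eq mult.assoc)

lemma cfourier_derivative: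
  assumes g: "test_fun g" and deriv: "\<forall>x. (g has_vector_derivative g' x) (at x)"
  shows "cfourier g' z = 2 * pi * \<i> * z * cfourier g z"
proof -
  have g': "test_fun g'"
    using assms by (rule test_fun_derivative)
  let ?a = "- (2 * pi * \<i>) * z"
  have "((\<lambda>t. g t * fourier_kernel z t) has_vector_derivative
      g t * (?a * fourier_kernel z t) + g' t * fourier_kernel z t) (at t)" for t
    by (intro has_vector_derivative_mult deriv[rule_format] fourier_kernel_has_vector_derivative)
  then have "(LINT t|lborel. g t * (?a * fourier_kernel z t) + g' t * fourier_kernel z t) = 0"
    by (intro LINT_derivative_test_fun_eq_0[OF
          test_fun_mult_smooth_fun[OF g smooth_fun_fourier_kernel]] allI)
  also have "(\<lambda>t. g t * (?a * fourier_kernel z t) + g' t * fourier_kernel z t) =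
      (\<lambda>t. ?a * (g t * fourier_kernel z t) + g' t * fourier_kernel z t)"
    by (simp only: mult_ac)
  also have "(LINT t|lborel. ?a * (g t * fourier_kernel z t) + g' t * fourier_kernel z t) =
      ?a * cfourier g z + cfourier g' z"
    using integrable_test_fun_mult[OF g continuous_on_fourier_kernel]
      integrable_test_fun_mult[OF g' continuous_on_fourier_kernel]
    by (simp only: cfourier_eq Bochner_Integration.integral_add integrable_mult_right
        integral_mult_right_zero)
  finally show ?thesis
    by (simp add: add_eq_0_iff)
qed

lemma cfourier_bounded_on_strip:
  assumes "test_fun g"
  obtains C where "C \<ge> 0" "\<And>z. z \<in> strip H \<Longrightarrow> norm (cfourier g z) \<le> C"
proof -
  obtain R where R: "R > 0" "\<And>x. \<bar>x\<bar> \<ge> R \<Longrightarrow> g x = 0"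
    using assms by (meson test_fun_supportE)
  show thesis
  proof
    fix z assume z: "z \<in> strip H"
    have "norm (fourier_kernel z t) \<le> exp (2 * pi * H * R)" if "g t \<noteq> 0" for t
    proof -
      have "\<bar>t\<bar> \<le> R" "0 \<le> H"
        using that R(2)[of t] z by (force simp: strip_def)+
      then have "exp (2 * pi * H * \<bar>t\<bar>) \<le> exp (2 * pi * H * R)"
        by (simp add: mult_left_mono)
      then show ?thesis
        using norm_fourier_kernel_le[OF z, of t] by linarith
    qed
    then show "norm (cfourier g z) \<le> (LINT t|lborel. norm (g t)) * exp (2 * pi * H * R)"
      unfolding cfourier_eq
      by (intro norm_LINT_test_fun_mult_le assms continuous_on_fourier_kernel)
  qed simp
qed

lemma norm_cfourier_diff_Re_le:
  assumes "test_fun g"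
  obtains C where "C \<ge> 0"
    "\<And>z. z \<in> strip H \<Longrightarrow> norm (cfourier g z - cfourier g (of_real (Re z))) \<le> C * \<bar>Im z\<bar>"
proof -
  obtain R where R: "R > 0" "\<And>x. \<bar>x\<bar> \<ge> R \<Longrightarrow> g x = 0"
    using assms by (meson test_fun_supportE)
  let ?K = "2 * pi * R * exp (2 * pi * H * R)"
  show thesis
  proof
    fix z assume z: "z \<in> strip H"
    let ?d = "\<lambda>t. fourier_kernel z t - fourier_kernel (of_real (Re z)) t"
    have "norm (?d t) \<le> ?K * \<bar>Im z\<bar>" if "g t \<noteq> 0" for t
    proof -
      have "\<bar>t\<bar> \<le> R" "\<bar>Im z\<bar> \<le> H"
        using that R(2)[of t] z by (force simp: strip_def)+
      then have "2 * pi * \<bar>t\<bar> * exp (2 * pi * \<bar>Im z\<bar> * \<bar>t\<bar>) * \<bar>Im z\<bar> \<le> ?K * \<bar>Im z\<bar>"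
        by (intro mult_right_mono mult_mono iffD2[OF exp_le_cancel_iff]) auto
      then show ?thesis
        using norm_fourier_kernel_diff_Re_le[of z t] by linarith
    qed
    then have "norm (LINT t|lborel. g t * ?d t) \<le> (LINT t|lborel. norm (g t)) * (?K * \<bar>Im z\<bar>)"
      by (intro norm_LINT_test_fun_mult_le assms continuous_intros)
    then show "norm (cfourier g z - cfourier g (of_real (Re z))) \<le>
        (LINT t|lborel. norm (g t)) * ?K * \<bar>Im z\<bar>"
      using integrable_test_fun_mult[OF assms continuous_on_fourier_kernel]
      by (simp add: cfourier_eq right_diff_distrib mult.assoc)
  qed (use R in simp)
qed

definition weight :: "real \<Rightarrow> nat \<Rightarrow> real \<Rightarrow> real" where
  "weight L n x = 1 / (1 + \<bar>x\<bar> / L) ^ n"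

lemma weight_nonneg: "L > 0 \<Longrightarrow> 0 \<le> weight L n x"
  by (simp add: weight_def)

lemma weight_divide: "L > 0 \<Longrightarrow> weight 1 n (x / L) = weight L n x"
  by (simp add: weight_def)

lemma cfourier_power_bounded_on_strip:
  assumes "test_fun g"
  obtains C where "C \<ge> 0" "\<And>z. z \<in> strip H \<Longrightarrow> \<bar>Re z\<bar> ^ n * norm (cfourier g z) \<le> C"
proof -
  have "\<exists>C\<ge>0. \<forall>z\<in>strip H. \<bar>Re z\<bar> ^ n * norm (cfourier g z) \<le> C"
    using assms
  proof (induction n arbitrary: g)
    case 0
    then show ?case using cfourier_bounded_on_strip[of g H] by (metis mult_1 power_0)
  next
    case (Suc n)
    obtain g' where g': "\<forall>x. (g has_vector_derivative g' x) (at x)" "test_fun g'"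
      using Suc.prems by (rule test_fun_has_derivativeE)
    obtain C where C: "C \<ge> 0" "\<And>z. z \<in> strip H \<Longrightarrow> \<bar>Re z\<bar> ^ n * norm (cfourier g' z) \<le> C"
      using Suc.IH[OF g'(2)] by blast
    have "\<bar>Re z\<bar> ^ Suc n * norm (cfourier g z) \<le> C" if "z \<in> strip H" for z
    proof -
      have "1 * \<bar>Re z\<bar> \<le> (2 * pi) * norm z"
        using pi_gt3 by (intro mult_mono abs_Re_le_cmod) auto
      then have "\<bar>Re z\<bar> * norm (cfourier g z) \<le> norm (cfourier g' z)"
        unfolding cfourier_derivative[OF Suc.prems g'(1)] norm_mult by (intro mult_right_mono) auto
      then have "\<bar>Re z\<bar> ^ n * (\<bar>Re z\<bar> * norm (cfourier g z)) \<le> \<bar>Re z\<bar> ^ n * norm (cfourier g' z)"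
        by (intro mult_left_mono) auto
      also have "\<dots> \<le> C" using C(2) that by blast
      finally show ?thesis by (simp add: mult_ac)
    qed
    then show ?case using C(1) by blast
  qed
  then show thesis using that by blast
qed

lemma power_one_plus_le:
  fixes x :: real
  assumes "x \<ge> 0"
  shows "(1 + x) ^ n \<le> 2 ^ n * (1 + x ^ n)"
proof -
  have "(1 + x) ^ n \<le> (2 * max 1 x) ^ n"
    using assms by (intro power_mono) auto
  also have "\<dots> \<le> 2 ^ n * (1 + x ^ n)"
    using assms by (simp add: power_mult_distrib max_def)
  finally show ?thesis .
qed

lemma cfourier_decay:
  assumes "test_fun g" and L: "L > 0"
  obtains C where "C \<ge> 0" "\<And>z. z \<in> strip H \<Longrightarrow> norm (cfourier g z) \<le> C * weight L n (Re z)"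
proof -
  obtain C0 where C0: "C0 \<ge> 0" "\<And>z. z \<in> strip H \<Longrightarrow> norm (cfourier g z) \<le> C0"
    using assms(1) by (meson cfourier_bounded_on_strip)
  obtain C1 where C1: "C1 \<ge> 0" "\<And>z. z \<in> strip H \<Longrightarrow> \<bar>Re z\<bar> ^ n * norm (cfourier g z) \<le> C1"
    using assms(1) by (meson cfourier_power_bounded_on_strip)
  show thesis
  proof
    show "2 ^ n * (C0 + C1 / L ^ n) \<ge> 0"
      using C0(1) C1(1) L by simp
    fix z assume z: "z \<in> strip H"
    have "(1 + \<bar>Re z\<bar> / L) ^ n * norm (cfourier g z) \<le>
        2 ^ n * (1 + (\<bar>Re z\<bar> / L) ^ n) * norm (cfourier g z)"
      using L by (intro mult_right_mono power_one_plus_le) auto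
    also have "\<dots> = 2 ^ n * (norm (cfourier g z) + \<bar>Re z\<bar> ^ n * norm (cfourier g z) / L ^ n)"
      by (simp add: power_divide algebra_simps)
    also have "\<dots> \<le> 2 ^ n * (C0 + C1 / L ^ n)"
      using C0(2)[OF z] C1(2)[OF z] L by (intro mult_left_mono add_mono divide_right_mono) auto
    finally show "norm (cfourier g z) \<le> 2 ^ n * (C0 + C1 / L ^ n) * weight L n (Re z)"
      using L by (simp add: weight_def pos_le_divide_eq add_pos_nonneg mult.commute)
  qed
qed

section \<open>Convolution\<close>

definition convolution :: "(real \<Rightarrow> complex) \<Rightarrow> (real \<Rightarrow> complex) \<Rightarrow> real \<Rightarrow> complex" where
  "convolution g h t = (LINT u|lborel. g u * h (t - u))"

lemma continuous_on_test_fun_compose [continuous_intros]: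
  assumes "test_fun g" "continuous_on A f"
  shows "continuous_on A (\<lambda>x. g (f x))"
  using test_fun_continuous_on[OF assms(1), of UNIV] assms(2) by (rule continuous_on_compose2) simp

lemma convolution_eq_integral:
  assumes "test_fun g" "test_fun h" "\<And>x. \<bar>x\<bar> \<ge> R \<Longrightarrow> g x = 0"
  shows "convolution g h t = integral (cbox (- R) R) (\<lambda>u. g u * h (t - u))"
proof -
  have "integrable lborel (\<lambda>u. g u * h (t - u))"
    by (intro integrable_test_fun_mult continuous_intros assms)
  then have "convolution g h t = integral UNIV (\<lambda>u. g u * h (t - u))"
    unfolding convolution_def by (rule integral_lborel[symmetric])
  also have "(\<lambda>u. g u * h (t - u)) = (\<lambda>u. if u \<in> cbox (- R) R then g u * h (t - u) else 0)"
    using assms(3) by (auto simp: fun_eq_iff)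
  finally show ?thesis
    by (simp only: integral_restrict_UNIV)
qed

lemma convolution_has_vector_derivative:
  assumes g: "test_fun g" and h: "test_fun h" "\<forall>x. (h has_vector_derivative h' x) (at x)"
  shows "(convolution g h has_vector_derivative convolution g h' x) (at x)"
proof -
  have h': "test_fun h'"
    using h by (rule test_fun_derivative)
  obtain R where R: "\<And>x. \<bar>x\<bar> \<ge> R \<Longrightarrow> g x = 0"
    using g by (meson test_fun_supportE)
  have "convolution g k = (\<lambda>t. integral (cbox (- R) R) (\<lambda>u. g u * k (t - u)))" if "test_fun k" for k
    by (intro ext convolution_eq_integral g that R)
  note this[OF h(1)] this[OF h']
  show ?thesis
    unfolding \<open>convolution g h = _\<close> \<open>convolution g h' = _\<close>
  proof (rule leibniz_rule_vector_derivative[where U=UNIV])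
    fix x t
    show "((\<lambda>x. g t * h (x - t)) has_vector_derivative g t * h' (x - t)) (at x)"
      using has_vector_derivative_affine_compose[OF h(2), of 1 "- t"]
      by (intro has_vector_derivative_mult_right) simp
    show "(\<lambda>u. g u * h (x - u)) integrable_on cbox (- R) R"
      by (intro integrable_continuous continuous_intros g h)
    show "continuous_on (UNIV \<times> cbox (- R) R) (\<lambda>(x, t). g t * h' (x - t))"
      unfolding case_prod_unfold by (intro continuous_intros g h')
  qed auto
qed

lemma test_fun_convolution:
  assumes g: "test_fun g" and h: "test_fun h"
  shows "test_fun (convolution g h)"
proof -
  obtain R R' where R: "\<And>x. \<bar>x\<bar> \<ge> R \<Longrightarrow> g x = 0" and R': "\<And>x. \<bar>x\<bar> \<ge> R' \<Longrightarrow> h x = 0"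
    using g h by (meson test_fun_supportE)
  show ?thesis
  proof (rule test_funI[of _ "R + R'"])
    show "smooth_fun (convolution g h)"
      using h
    proof (coinduction arbitrary: h)
      case smooth_fun
      then obtain h' where "\<forall>x. (h has_vector_derivative h' x) (at x)" "test_fun h'"
        by (rule test_fun_has_derivativeE)
      with smooth_fun show ?case
        using convolution_has_vector_derivative[OF g, of h h']
        by (intro exI[of _ "convolution g h"] exI[of _ "convolution g h'"]) auto
    qed
    fix x assume "\<bar>x\<bar> > R + R'"
    then have "\<bar>u\<bar> \<ge> R \<or> \<bar>x - u\<bar> \<ge> R'" for u
      by linarith
    then have "(\<lambda>u. g u * h (x - u)) = (\<lambda>_. 0)"
      using R R' by (metis mult_zero_left mult_zero_right)
    then show "convolution g h x = 0"
      unfolding convolution_def by simp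
  qed
qed

lemma integrable_convolution_kernel:
  assumes g: "test_fun g" and h: "test_fun h" and "continuous_on UNIV k"
  shows "integrable (lborel \<Otimes>\<^sub>M lborel) (\<lambda>(t, u). g u * h (t - u) * k t)"
proof -
  obtain R R' where R: "\<And>x. \<bar>x\<bar> \<ge> R \<Longrightarrow> g x = 0" and R': "\<And>x. \<bar>x\<bar> \<ge> R' \<Longrightarrow> h x = 0"
    using g h by (meson test_fun_supportE)
  have "integrable lborel (\<lambda>p :: real \<times> real. g (snd p) * h (fst p - snd p) * k (fst p))"
  proof (rule integrable_continuous_compact_support)
    show "continuous_on UNIV (\<lambda>p. g (snd p) * h (fst p - snd p) * k (fst p))"
      by (intro continuous_intros g h continuous_on_compose2[OF assms(3)]) auto
    show "compact (cbox (- (R + R')) (R + R') \<times> cbox (- R) R)"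
      by (intro compact_Times compact_cbox)
    fix p :: "real \<times> real"
    assume "p \<notin> cbox (- (R + R')) (R + R') \<times> cbox (- R) R"
    then have "\<bar>snd p\<bar> \<ge> R \<or> \<bar>fst p - snd p\<bar> \<ge> R'"
      by (cases p) auto
    then show "g (snd p) * h (fst p - snd p) * k (fst p) = 0"
      using R R' by auto
  qed
  then show ?thesis
    by (simp add: lborel_prod case_prod_unfold)
qed

lemma cfourier_convolution:
  assumes g: "test_fun g" and h: "test_fun h"
  shows "cfourier (convolution g h) z = cfourier g z * cfourier h z"
proof -
  have "cfourier (convolution g h) z =
      (LINT t|lborel. LINT u|lborel. g u * h (t - u) * fourier_kernel z t)"
    by (simp add: cfourier_eq convolution_def)
  also have "\<dots> = (LINT u|lborel. LINT t|lborel. g u * h (t - u) * fourier_kernel z t)"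
    using lborel_pair.Fubini_integral[OF
        integrable_convolution_kernel[OF g h continuous_on_fourier_kernel]] by simp
  also have "\<dots> = (LINT u|lborel. g u * cfourier (\<lambda>t. h (t - u)) z)"
    by (simp add: cfourier_eq mult.assoc)
  also have "\<dots> = cfourier g z * cfourier h z"
    by (simp add: cfourier_translate) (simp add: cfourier_eq flip: mult.assoc)
  finally show ?thesis .
qed

section \<open>An almost positive kernel\<close>

lemma cfourier_of_real_in_Reals:
  assumes "\<And>t. g (- t) = cnj (g t)"
  shows "cfourier g (of_real x) \<in> \<real>"
proof -
  have "cnj (cfourier g (of_real x)) = (LINT t|lborel. cnj (g t * fourier_kernel (of_real x) t))"
    unfolding cfourier_eq by (rule Bochner_Integration.integral_cnj[symmetric])
  also have "\<dots> = (LINT t|lborel. g (- t) * fourier_kernel (of_real x) (- t))"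
    by (simp add: assms fourier_kernel_of_real cis_cnj)
  also have "\<dots> = cfourier g (of_real x)"
    unfolding cfourier_eq by (subst (2) lborel_integral_real_affine[of "-1" _ 0]) auto
  finally show ?thesis
    by (simp only: Reals_cnj_iff)
qed

lemma bump_mult_cos_ge:
  assumes r: "r > 0" and x: "\<bar>x\<bar> * r \<le> 1 / 8"
  shows "exp (- 4 / r) / 2 * indicator {- r / 2..r / 2} t \<le> bump r t * cos (2 * pi * x * t)"
proof (cases "\<bar>t\<bar> \<le> r")
  case True
  have "\<bar>x\<bar> * \<bar>t\<bar> \<le> 1 / 8"
    using mult_left_mono[OF True, of "\<bar>x\<bar>"] x by linarith
  then have "\<bar>2 * pi * x * t\<bar> \<le> pi / 3"
    by (simp add: abs_mult mult.assoc)
  then have "cos (pi / 3) \<le> cos \<bar>2 * pi * x * t\<bar>"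
    by (intro cos_monotone_0_pi_le) auto
  then have "1 / 2 \<le> cos (2 * pi * x * t)"
    by (simp add: cos_60)
  moreover have "exp (- 4 / r) * indicator {- r / 2..r / 2} t \<le> bump r t"
    using bump_ge[OF r, of t] bump_nonneg[of r t] by (auto simp: indicator_def)
  ultimately have "(exp (- 4 / r) * indicator {- r / 2..r / 2} t) * (1 / 2) \<le>
      bump r t * cos (2 * pi * x * t)"
    using bump_nonneg by (intro mult_mono) auto
  then show ?thesis by simp
next
  case False
  then show ?thesis by (auto simp: bump_eq_0 indicator_def)
qed

lemma Re_cfourier_bump_ge:
  assumes r: "r > 0" and x: "\<bar>x\<bar> * r \<le> 1 / 8"
  shows "Re (cfourier (\<lambda>t. of_real (bump r t)) (of_real x)) \<ge> exp (- 4 / r) * r / 2"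
proof -
  let ?f = "\<lambda>t. of_real (bump r t) * fourier_kernel (of_real x) t"
  have int: "integrable lborel ?f"
    by (intro integrable_test_fun_mult test_fun_bump continuous_intros)
  have "exp (- 4 / r) * r / 2 = (LINT t|lborel. exp (- 4 / r) / 2 * indicator {- r / 2..r / 2} t)"
    using r by simp
  also have "\<dots> \<le> (LINT t|lborel. Re (?f t))"
  proof (rule integral_mono)
    show "integrable lborel (\<lambda>t. exp (- 4 / r) / 2 * indicator {- r / 2..r / 2} t)"
      by (intro integrable_mult_right integrable_real_indicator) (auto simp: emeasure_lborel_Icc_eq)
    show "integrable lborel (\<lambda>t. Re (?f t))"
      using int by (rule integrable_Re)
    show "exp (- 4 / r) / 2 * indicator {- r / 2..r / 2} t \<le> Re (?f t)" for t
      using bump_mult_cos_ge[OF assms] by (simp add: fourier_kernel_of_real)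
  qed
  also have "\<dots> = Re (cfourier (\<lambda>t. of_real (bump r t)) (of_real x))"
    unfolding cfourier_eq using int by (rule integral_Re)
  finally show ?thesis .
qed

lemma Re_square_diff_le:
  fixes v w :: complex
  assumes "norm (v - w) \<le> d" "norm v \<le> a" "norm w \<le> a" "w \<in> \<real>"
  shows "(Re w)\<^sup>2 - 2 * a * d \<le> Re (v * v)"
proof -
  have "norm (w * w - v * v) = norm (v - w) * norm (v + w)"
    by (simp add: algebra_simps norm_minus_commute flip: norm_mult)
  also have "\<dots> \<le> d * (a + a)"
    using assms(1-3) norm_triangle_ineq[of v w] norm_ge_zero[of "v - w"]
    by (intro mult_mono norm_ge_zero) linarith+
  finally have "Re (w * w - v * v) \<le> 2 * a * d"
    using complex_Re_le_cmod[of "w * w - v * v"] by (simp add: mult_ac)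
  moreover have "Re (w * w) = (Re w)\<^sup>2"
    using assms(4) by (auto simp: power2_eq_square elim: Reals_cases)
  ultimately show ?thesis by simp
qed

lemma Re_cfourier_convolution_self_ge:
  assumes g: "test_fun g" and hermitian: "\<And>t. g (- t) = cnj (g t)" and L: "L > 0"
  obtains C where "C \<ge> 0" "\<And>z. z \<in> strip H \<Longrightarrow>
    (Re (cfourier g (of_real (Re z))))\<^sup>2 - C * \<bar>Im z\<bar> * weight L n (Re z) \<le>
      Re (cfourier (convolution g g) z)"
proof -
  obtain C1 where C1: "C1 \<ge> 0"
    "\<And>z. z \<in> strip H \<Longrightarrow> norm (cfourier g z) \<le> C1 * weight L n (Re z)"
    using cfourier_decay[OF g L] by metis
  obtain C2 where C2: "C2 \<ge> 0"
    "\<And>z. z \<in> strip H \<Longrightarrow> norm (cfourier g z - cfourier g (of_real (Re z))) \<le> C2 * \<bar>Im z\<bar>"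
    using norm_cfourier_diff_Re_le[OF g] by metis
  show thesis
  proof
    show "2 * C1 * C2 \<ge> 0"
      using C1(1) C2(1) by simp
    fix z assume z: "z \<in> strip H"
    let ?v = "cfourier g z" and ?w = "cfourier g (of_real (Re z))"
    have "(Re ?w)\<^sup>2 - 2 * (C1 * weight L n (Re z)) * (C2 * \<bar>Im z\<bar>) \<le> Re (?v * ?v)"
      using C1(2)[of z] C1(2)[of "of_real (Re z)"] C2(2)[of z] z
      by (intro Re_square_diff_le cfourier_of_real_in_Reals hermitian) (auto simp: strip_def)
    then show "(Re ?w)\<^sup>2 - 2 * C1 * C2 * \<bar>Im z\<bar> * weight L n (Re z) \<le>
        Re (cfourier (convolution g g) z)"
      by (simp add: cfourier_convolution g mult_ac)
  qed
qed

definition window :: "real \<Rightarrow> real \<Rightarrow> complex set" where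
  "window L s = {z. \<bar>Re z - s\<bar> \<le> L}"

lemma divide_mem_window_iff: "L > 0 \<Longrightarrow> z / of_real L \<in> window 1 0 \<longleftrightarrow> z \<in> window L 0"
  by (simp add: window_def)

lemma almost_positive_kernel:
  obtains \<psi> C where "test_fun \<psi>" "C \<ge> 0" "\<And>z. z \<in> strip 1 \<Longrightarrow>
    indicator (window 1 0) z - C * \<bar>Im z\<bar> * weight 1 n (Re z) \<le> Re (cfourier \<psi> z)"
proof -
  let ?\<chi> = "\<lambda>t. complex_of_real (bump (1 / 8) t)"
  have \<chi>: "test_fun ?\<chi>" by (rule test_fun_bump)
  define c :: real where "c = exp (- 32) / 16"
  have c: "c > 0" by (simp add: c_def)
  have c_le: "c \<le> Re (cfourier ?\<chi> (of_real x))" if "\<bar>x\<bar> \<le> 1" for x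
    using Re_cfourier_bump_ge[of "1 / 8" x] that by (simp add: c_def)
  obtain C where C: "C \<ge> 0" "\<And>z. z \<in> strip 1 \<Longrightarrow>
      (Re (cfourier ?\<chi> (of_real (Re z))))\<^sup>2 - C * \<bar>Im z\<bar> * weight 1 n (Re z) \<le>
        Re (cfourier (convolution ?\<chi> ?\<chi>) z)"
    by (rule Re_cfourier_convolution_self_ge[OF \<chi> _ zero_less_one, of 1 n]) auto
  define \<psi> where "\<psi> t = of_real (1 / c\<^sup>2) * convolution ?\<chi> ?\<chi> t" for t
  have Re_\<psi>: "Re (cfourier \<psi> z) = Re (cfourier (convolution ?\<chi> ?\<chi>) z) / c\<^sup>2" for z
    unfolding \<psi>_def[abs_def] cfourier_cmult by (simp flip: of_real_power)
  show thesis
  proof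
    show "test_fun \<psi>"
      unfolding \<psi>_def[abs_def] by (intro test_fun_cmult test_fun_convolution \<chi>)
    show "C / c\<^sup>2 \<ge> 0"
      using C(1) by simp
    fix z assume z: "z \<in> strip 1"
    have "c\<^sup>2 * indicator (window 1 0) z \<le> (Re (cfourier ?\<chi> (of_real (Re z))))\<^sup>2"
      using c c_le[of "Re z"] by (auto simp: indicator_def window_def intro!: power_mono)
    with C(2)[OF z] show "indicator (window 1 0) z - C / c\<^sup>2 * \<bar>Im z\<bar> * weight 1 n (Re z) \<le>
        Re (cfourier \<psi> z)"
      using c by (simp add: Re_\<psi> pos_le_divide_eq right_diff_distrib mult.commute)
  qed
qed

lemma almost_positive_kernel_wide:
  assumes H: "H > 0" and \<epsilon>: "\<epsilon> > 0"
  obtains L g where "L > 0" "test_fun g"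
    "\<And>z. z \<in> strip H \<Longrightarrow> indicator (window L 0) z - \<epsilon> * weight L n (Re z) \<le> Re (cfourier g z)"
proof -
  obtain \<psi> C where \<psi>: "test_fun \<psi>" and C: "C \<ge> 0" and low: "\<And>z. z \<in> strip 1 \<Longrightarrow>
      indicator (window 1 0) z - C * \<bar>Im z\<bar> * weight 1 n (Re z) \<le> Re (cfourier \<psi> z)"
    using almost_positive_kernel[of n] by metis
  define L where "L = max H (C * H / \<epsilon>)"
  have L: "L > 0" "H \<le> L" "C * H / \<epsilon> \<le> L"
    using H by (auto simp: L_def)
  have CH: "C * (H / L) \<le> \<epsilon>"
    using L(1,3) \<epsilon> by (simp add: field_simps)
  define g where "g t = of_real L * \<psi> (L * t)" for t
  have cfourier_g: "cfourier g z = cfourier \<psi> (z / of_real L)" for z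
    unfolding g_def[abs_def] cfourier_cmult cfourier_dilate[OF L(1)] using L(1) by simp
  show thesis
  proof
    show "test_fun g"
      unfolding g_def[abs_def] using test_fun_affine_compose[OF \<psi>, of L 0] L(1)
      by (intro test_fun_cmult) simp
    fix z assume z: "z \<in> strip H"
    then have "C * (\<bar>Im z\<bar> / L) \<le> C * (H / L)"
      using L(1) C by (intro mult_left_mono divide_right_mono) (auto simp: strip_def)
    then have "C * (\<bar>Im z\<bar> / L) * weight L n (Re z) \<le> \<epsilon> * weight L n (Re z)"
      using CH L(1) by (intro mult_right_mono weight_nonneg) linarith+
    moreover have "z / of_real L \<in> strip 1"
      using z L by (simp add: strip_def)
    then have "indicator (window L 0) z - C * (\<bar>Im z\<bar> / L) * weight L n (Re z)
        \<le> Re (cfourier \<psi> (z / of_real L))"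
      using low[of "z / of_real L"] L(1)
      by (simp add: weight_divide indicator_def divide_mem_window_iff)
    ultimately show "indicator (window L 0) z - \<epsilon> * weight L n (Re z) \<le> Re (cfourier g z)"
      unfolding cfourier_g by linarith
  qed (rule L(1))
qed

section \<open>Masses of vertical windows\<close>

lemma window_borel [measurable]: "window L s \<in> sets borel"
  unfolding window_def by measurable

definition translation_bounded :: "complex measure \<Rightarrow> bool" where
  "translation_bounded \<nu> \<longleftrightarrow> (\<exists>L>0. \<exists>M\<ge>0. \<forall>s. emeasure \<nu> (window L s) \<le> ennreal M)"

definition moderate :: "real \<Rightarrow> nat \<Rightarrow> (real \<Rightarrow> real) \<Rightarrow> bool" where
  "moderate L q V \<longleftrightarrow>
    L > 0 \<and> (\<forall>s. 0 \<le> V s) \<and> (\<forall>s x. V (s + x) \<le> (1 + \<bar>x\<bar> / L) ^ q * V s)"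

lemma moderate_power:
  assumes "L > 0"
  shows "moderate L q (\<lambda>s. (1 + \<bar>s\<bar> / L) ^ q)"
  unfolding moderate_def
proof (intro conjI allI)
  fix s x :: real
  have "1 + \<bar>s + x\<bar> / L \<le> 1 + (\<bar>s\<bar> + \<bar>x\<bar>) / L"
    using assms by (intro add_left_mono divide_right_mono) auto
  also have "\<dots> \<le> (1 + \<bar>x\<bar> / L) * (1 + \<bar>s\<bar> / L)"
    using assms by (simp add: algebra_simps add_divide_distrib)
  finally show "(1 + \<bar>s + x\<bar> / L) ^ q \<le> (1 + \<bar>x\<bar> / L) ^ q * (1 + \<bar>s\<bar> / L) ^ q"
    using assms by (simp add: power_mono flip: power_mult_distrib)
qed (use assms in simp_all)

lemma moderate_affine:
  assumes V: "moderate L q V" and "a \<ge> 0" "c \<ge> 0"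
  shows "moderate L q (\<lambda>s. a + c * V s)"
  unfolding moderate_def
proof (intro conjI allI)
  show L: "L > 0"
    using V by (simp add: moderate_def)
  fix s x
  show "0 \<le> a + c * V s"
    using assms by (simp add: moderate_def)
  have "1 * a \<le> (1 + \<bar>x\<bar> / L) ^ q * a"
    using L assms(2) by (intro mult_right_mono one_le_power) auto
  moreover have "c * V (s + x) \<le> c * ((1 + \<bar>x\<bar> / L) ^ q * V s)"
    using assms by (intro mult_left_mono) (auto simp: moderate_def)
  ultimately show "a + c * V (s + x) \<le> (1 + \<bar>x\<bar> / L) ^ q * (a + c * V s)"
    by (simp add: algebra_simps)
qed

lemma moderate_const: "L > 0 \<Longrightarrow> c \<ge> 0 \<Longrightarrow> moderate L q (\<lambda>_. c)"
  using moderate_affine[OF moderate_power, of L c 0 q] by simp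

definition window_majorant :: "complex measure \<Rightarrow> real \<Rightarrow> nat \<Rightarrow> (real \<Rightarrow> real) \<Rightarrow> bool" where
  "window_majorant \<nu> L q V \<longleftrightarrow>
    moderate L q V \<and> (\<forall>s. emeasure \<nu> (window L s) \<le> ennreal (V s))"

lemma window_majorantD:
  assumes "window_majorant \<nu> L q V"
  shows "L > 0" "V s \<ge> 0" "V (s + x) \<le> (1 + \<bar>x\<bar> / L) ^ q * V s"
    and "emeasure \<nu> (window L s) \<le> ennreal (V s)"
  using assms by (simp_all add: window_majorant_def moderate_def)

lemma weight_le_suminf_windows:
  assumes "L > 0"
  shows "ennreal (weight L m (Re z - s)) \<le>
    (\<Sum>n. ennreal (1 / (1 + real n) ^ m) *
      indicator (window L (s + real n * L) \<union> window L (s - real n * L)) z)"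
    (is "_ \<le> (\<Sum>n. ?c n * indicator (?S n) z)")
proof -
  define n where "n = nat \<lfloor>\<bar>Re z - s\<bar> / L\<rfloor>"
  have "\<bar>Re z - s\<bar> / L \<ge> 0"
    using assms by simp
  then have n: "real n \<le> \<bar>Re z - s\<bar> / L" "\<bar>Re z - s\<bar> / L \<le> real n + 1"
    unfolding n_def by linarith+
  have "weight L m (Re z - s) \<le> 1 / (1 + real n) ^ m"
    unfolding weight_def using n(1) assms
    by (intro divide_left_mono power_mono mult_pos_pos zero_less_power) auto
  moreover have "real n * L \<le> \<bar>Re z - s\<bar>" "\<bar>Re z - s\<bar> \<le> real n * L + L"
    using n assms by (simp_all add: field_simps)
  then have "z \<in> ?S n"
    unfolding window_def by (simp, linarith)
  ultimately have "ennreal (weight L m (Re z - s)) \<le> ?c n * indicator (?S n) z"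
    by (simp add: ennreal_leI)
  also have "\<dots> \<le> (\<Sum>n. ?c n * indicator (?S n) z)"
  proof -
    have "a n \<le> suminf a" for a :: "nat \<Rightarrow> ennreal"
      using sum_le_suminf[OF summableI, of "{n}" a] by simp
    then show ?thesis .
  qed
  finally show ?thesis .
qed

lemma emeasure_window_pair_le:
  assumes "sets \<nu> = sets borel" and V: "window_majorant \<nu> L q V"
  shows "emeasure \<nu> (window L (s + real n * L) \<union> window L (s - real n * L)) \<le>
    ennreal (2 * ((1 + real n) ^ q * V s))"
proof -
  have V_le: "V (s + x) \<le> (1 + real n) ^ q * V s" if "\<bar>x\<bar> = real n * L" for x
    using window_majorantD(3)[OF V, of s x] that window_majorantD(1)[OF V] by simp
  have "emeasure \<nu> (window L (s + real n * L) \<union> window L (s - real n * L)) \<le>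
      emeasure \<nu> (window L (s + real n * L)) + emeasure \<nu> (window L (s + - (real n * L)))"
    using assms(1) by (simp add: emeasure_subadditive window_borel)
  also have "\<dots> \<le> ennreal ((1 + real n) ^ q * V s) + ennreal ((1 + real n) ^ q * V s)"
    using window_majorantD(1)[OF V]
    by (intro add_mono order_trans[OF window_majorantD(4)[OF V]] ennreal_leI V_le) auto
  also have "\<dots> = ennreal (2 * ((1 + real n) ^ q * V s))"
    using window_majorantD(2)[OF V] by (subst ennreal_plus[symmetric]) auto
  finally show ?thesis .
qed

lemma nn_integral_weight_le:
  assumes sets: "sets \<nu> = sets borel" and V: "window_majorant \<nu> L q V"
  shows "(\<integral>\<^sup>+ z. ennreal (weight L (q + 2) (Re z - s)) \<partial>\<nu>) \<le> ennreal (pi\<^sup>2 / 3 * V s)"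
proof -
  define S where "S n = window L (s + real n * L) \<union> window L (s - real n * L)" for n
  define c where "c n = 1 / (1 + real n) ^ (q + 2)" for n
  have S: "S n \<in> sets \<nu>" for n
    by (simp add: S_def sets window_borel)
  have squares: "(\<lambda>n. 2 * V s * (1 / (real n + 1)\<^sup>2)) sums (2 * V s * (pi\<^sup>2 / 6))"
    using sums_mult[OF inverse_squares_sums, of "2 * V s"] by (simp add: add.commute)
  have "(\<integral>\<^sup>+ z. ennreal (weight L (q + 2) (Re z - s)) \<partial>\<nu>) \<le>
      (\<integral>\<^sup>+ z. (\<Sum>n. ennreal (c n) * indicator (S n) z) \<partial>\<nu>)"
    unfolding S_def c_def
    by (intro nn_integral_mono weight_le_suminf_windows window_majorantD(1)[OF V])
  also have "\<dots> = (\<Sum>n. \<integral>\<^sup>+ z. ennreal (c n) * indicator (S n) z \<partial>\<nu>)"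
    by (intro nn_integral_suminf borel_measurable_times_ennreal borel_measurable_const
        borel_measurable_indicator S)
  also have "\<dots> = (\<Sum>n. ennreal (c n) * emeasure \<nu> (S n))"
    using S by (simp add: nn_integral_cmult_indicator)
  also have "\<dots> \<le> (\<Sum>n. ennreal (2 * V s * (1 / (real n + 1)\<^sup>2)))"
  proof (rule suminf_le)
    fix n
    have "ennreal (c n) * emeasure \<nu> (S n) \<le> ennreal (c n) * ennreal (2 * ((1 + real n) ^ q * V s))"
      unfolding S_def by (intro mult_left_mono emeasure_window_pair_le sets V) auto
    also have "\<dots> = ennreal (c n * (2 * ((1 + real n) ^ q * V s)))"
      using window_majorantD(2)[OF V] by (intro ennreal_mult[symmetric]) (auto simp: c_def)
    also have "c n * (2 * ((1 + real n) ^ q * V s)) = 2 * V s * (1 / (real n + 1)\<^sup>2)"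
      by (simp add: c_def power_add power2_eq_square add.commute)
    finally show "ennreal (c n) * emeasure \<nu> (S n) \<le> ennreal (2 * V s * (1 / (real n + 1)\<^sup>2))" .
  qed (auto intro: summableI)
  also have "\<dots> = ennreal (\<Sum>n. 2 * V s * (1 / (real n + 1)\<^sup>2))"
    using window_majorantD(2)[OF V] sums_summable[OF squares] by (intro suminf_ennreal2) auto
  also have "(\<Sum>n. 2 * V s * (1 / (real n + 1)\<^sup>2)) = pi\<^sup>2 / 3 * V s"
    unfolding sums_unique[OF squares, symmetric] by simp
  finally show ?thesis .
qed

lemma
  assumes sets: "sets \<nu> = sets borel" and V: "window_majorant \<nu> L q V"
  shows integrable_weight: "integrable \<nu> (\<lambda>z. weight L (q + 2) (Re z - s))" (is ?int)
    and LINT_weight_le: "(LINT z|\<nu>. weight L (q + 2) (Re z - s)) \<le> pi\<^sup>2 / 3 * V s" (is ?le)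
proof -
  have meas: "(\<lambda>z. weight L (q + 2) (Re z - s)) \<in> borel_measurable \<nu>"
    unfolding measurable_cong_sets[OF sets refl] weight_def by measurable
  note nn_integral = nn_integral_weight_le[OF assms, of s]
  show ?int
    using meas nn_integral window_majorantD(1)[OF V]
    by (intro integrableI_bounded) (auto simp: weight_nonneg intro: le_less_trans)
  show ?le
    using meas nn_integral window_majorantD(1,2)[OF V]
    by (intro integral_real_bounded) (auto simp: weight_nonneg)
qed

lemma norm_LINT_le_weight:
  fixes G :: "complex \<Rightarrow> complex"
  assumes sets: "sets \<nu> = sets borel" and V: "window_majorant \<nu> L q V"
    and C: "C \<ge> 0" and G: "AE z in \<nu>. norm (G z) \<le> C * weight L (q + 2) (Re z - s)"
  shows "norm (LINT z|\<nu>. G z) \<le> C * (pi\<^sup>2 / 3 * V s)"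
proof -
  have "norm (LINT z|\<nu>. G z) \<le> (LINT z|\<nu>. norm (G z))"
    by (rule integral_norm_bound)
  also have "\<dots> \<le> (LINT z|\<nu>. C * weight L (q + 2) (Re z - s))"
    using integrable_weight[OF sets V] G C window_majorantD(1)[OF V]
    by (intro integral_mono_AE') (auto simp: weight_nonneg)
  also have "\<dots> = C * (LINT z|\<nu>. weight L (q + 2) (Re z - s))"
    by (rule integral_mult_right_zero)
  also have "\<dots> \<le> C * (pi\<^sup>2 / 3 * V s)"
    using LINT_weight_le[OF sets V] C by (rule mult_left_mono)
  finally show ?thesis .
qed

lemma window_mass_bounded_by_iteration:
  assumes A: "A \<ge> 0" and V: "window_majorant \<nu> L q V"
    and improve: "\<And>W s. window_majorant \<nu> L q W \<Longrightarrow>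
      emeasure \<nu> (window L s) \<le> ennreal (A + W s / 2)"
  shows "emeasure \<nu> (window L s) \<le> ennreal (2 * A)"
proof -
  have iterate: "window_majorant \<nu> L q (\<lambda>s. 2 * A + (1 / 2) ^ n * V s)" for n
  proof (induction n)
    case 0
    have "ennreal (V s) \<le> ennreal (2 * A + V s)" for s
      using A by (intro ennreal_leI) simp
    then show ?case
      using V A moderate_affine[of L q V "2 * A" 1]
      by (auto simp: window_majorant_def intro: order_trans)
  next
    case (Suc n)
    have "emeasure \<nu> (window L s) \<le> ennreal (A + (2 * A + (1 / 2) ^ n * V s) / 2)" for s
      by (rule improve[OF Suc.IH])
    then show ?case
      using V A moderate_affine[of L q V "2 * A" "(1 / 2) ^ Suc n"]
      by (simp add: window_majorant_def add_divide_distrib)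
  qed
  have "(\<lambda>n. 2 * A + (1 / 2) ^ n * V s) \<longlonglongrightarrow> 2 * A + 0 * V s"
    by (intro tendsto_intros LIMSEQ_power_zero) auto
  then have "(\<lambda>n. ennreal (2 * A + (1 / 2) ^ n * V s)) \<longlonglongrightarrow> ennreal (2 * A)"
    by (intro tendsto_ennrealI) simp
  then show ?thesis
    using window_majorantD(4)[OF iterate] by (intro LIMSEQ_le_const) auto
qed

section \<open>Locally summable coefficients\<close>

definition locally_abs_summable :: "(real \<Rightarrow> complex) \<Rightarrow> real set \<Rightarrow> bool" where
  "locally_abs_summable b \<Gamma> \<longleftrightarrow>
    (\<forall>K. compact K \<longrightarrow> (\<lambda>\<gamma>. norm (b \<gamma>)) summable_on (\<Gamma> \<inter> K))"

lemma cFT_pure_pointD: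
  assumes "cFT_pure_point \<nu> f \<Gamma> b"
  shows "locally_abs_summable b \<Gamma>"
    and "test_fun g \<Longrightarrow> cFT_meas \<nu> f g = (\<Sum>\<^sub>\<infinity>\<gamma>\<in>\<Gamma>. b \<gamma> * g \<gamma>)"
  using assms by (auto simp: cFT_pure_point_def locally_abs_summable_def)

lemma locally_abs_summable_bounded:
  assumes "locally_abs_summable b \<Gamma>" "bounded A"
  shows "(\<lambda>\<gamma>. norm (b \<gamma>)) summable_on (\<Gamma> \<inter> A)"
proof -
  have "compact (closure A)"
    using assms(2) by simp
  then have "(\<lambda>\<gamma>. norm (b \<gamma>)) summable_on (\<Gamma> \<inter> closure A)"
    using assms(1) unfolding locally_abs_summable_def by blast
  then show ?thesis
    by (rule summable_on_subset_banach) (use closure_subset in auto)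
qed

lemma locally_abs_summable_mult_test_fun:
  assumes "locally_abs_summable b \<Gamma>" "test_fun g"
  shows "(\<lambda>\<gamma>. norm (b \<gamma>) * norm (g \<gamma>)) summable_on \<Gamma>"
proof -
  obtain R where R: "\<And>x. \<bar>x\<bar> \<ge> R \<Longrightarrow> g x = 0"
    using assms(2) by (meson test_fun_supportE)
  have "compact (g ` {-R..R})"
    by (intro compact_continuous_image test_fun_continuous_on assms) auto
  then obtain B where B: "\<And>x. x \<in> {-R..R} \<Longrightarrow> norm (g x) \<le> B"
    using compact_imp_bounded[of "g ` {-R..R}"] unfolding bounded_iff by blast
  have "(\<lambda>\<gamma>. norm (b \<gamma>) * B) summable_on (\<Gamma> \<inter> {-R..R})"
    by (intro summable_on_cmult_left locally_abs_summable_bounded assms) simp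
  then have "(\<lambda>\<gamma>. norm (b \<gamma>) * norm (g \<gamma>)) summable_on (\<Gamma> \<inter> {-R..R})"
    by (rule summable_on_comparison_test) (use B in \<open>auto intro!: mult_left_mono\<close>)
  also have "?this \<longleftrightarrow> ?thesis"
    using R by (intro summable_on_cong_neutral) force+
  finally show ?thesis .
qed

lemma pp_var_nonneg: "pp_var \<Gamma> b A \<ge> 0"
  unfolding pp_var_def by (intro infsum_nonneg) auto

lemma pp_var_mono:
  assumes "locally_abs_summable b \<Gamma>" "bounded B" "A \<subseteq> B"
  shows "pp_var \<Gamma> b A \<le> pp_var \<Gamma> b B"
  unfolding pp_var_def using bounded_subset[OF assms(2,3)] assms(2,3)
  by (intro infsum_mono2 locally_abs_summable_bounded[OF assms(1)]) auto

lemma pp_var_Un_le: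
  assumes "locally_abs_summable b \<Gamma>" "bounded A" "bounded B"
  shows "pp_var \<Gamma> b (A \<union> B) \<le> pp_var \<Gamma> b A + pp_var \<Gamma> b B"
proof -
  have "pp_var \<Gamma> b (A \<union> (B - A)) = pp_var \<Gamma> b A + pp_var \<Gamma> b (B - A)"
    unfolding pp_var_def Int_Un_distrib using assms(2,3)
    by (intro infsum_Un_disjoint locally_abs_summable_bounded[OF assms(1)])
      (auto intro: bounded_subset)
  also have "pp_var \<Gamma> b (B - A) \<le> pp_var \<Gamma> b B"
    using assms by (intro pp_var_mono) auto
  finally show ?thesis
    by (simp add: Un_Diff_cancel)
qed

lemma pp_var_UN_le:
  assumes "locally_abs_summable b \<Gamma>" "finite J" "\<And>j. j \<in> J \<Longrightarrow> bounded (A j)"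
  shows "pp_var \<Gamma> b (\<Union>j\<in>J. A j) \<le> (\<Sum>j\<in>J. pp_var \<Gamma> b (A j))"
  using assms(2,3)
proof (induction J rule: finite_induct)
  case empty
  then show ?case by (simp add: pp_var_def)
next
  case (insert j J)
  have "pp_var \<Gamma> b (A j \<union> (\<Union>j\<in>J. A j)) \<le> pp_var \<Gamma> b (A j) + pp_var \<Gamma> b (\<Union>j\<in>J. A j)"
    using insert by (intro pp_var_Un_le assms(1)) auto
  then show ?case using insert by fastforce
qed

lemma interval_subset_UN_intervals:
  fixes t \<rho> d :: real
  assumes "d > 0"
  shows "{t - \<rho><..<t + \<rho>} \<subseteq>
    (\<Union>j\<le>nat \<lfloor>2 * \<rho> / d\<rfloor>. {t - \<rho> + real j * d - d..t - \<rho> + real j * d + d})"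
proof
  fix x assume x: "x \<in> {t - \<rho><..<t + \<rho>}"
  define j where "j = nat \<lfloor>(x - t + \<rho>) / d\<rfloor>"
  have y: "0 \<le> (x - t + \<rho>) / d" "(x - t + \<rho>) / d \<le> 2 * \<rho> / d"
    using x assms by (auto intro!: divide_right_mono)
  then have "j \<le> nat \<lfloor>2 * \<rho> / d\<rfloor>"
    unfolding j_def by (intro nat_mono floor_mono)
  moreover have "real j \<le> (x - t + \<rho>) / d" "(x - t + \<rho>) / d \<le> real j + 1"
    unfolding j_def using y by linarith+
  then have "real j * d \<le> x - t + \<rho>" "x - t + \<rho> \<le> real j * d + d"
    using assms by (auto simp: field_simps)
  then have "x \<in> {t - \<rho> + real j * d - d..t - \<rho> + real j * d + d}"
    using assms by auto
  ultimately show "x \<in> (\<Union>j\<le>nat \<lfloor>2 * \<rho> / d\<rfloor>. {t - \<rho> + real j * d - d..t - \<rho> + real j * d + d})"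
    by blast
qed

lemma pp_var_interval_le:
  assumes "locally_abs_summable b \<Gamma>" and d: "d > 0" and \<rho>: "\<rho> \<ge> 0" and G: "mono G"
    and local: "\<And>t. pp_var \<Gamma> b {t - d..t + d} \<le> G \<bar>t\<bar>"
  shows "pp_var \<Gamma> b {t - \<rho><..<t + \<rho>} \<le> (2 * \<rho> / d + 1) * G (\<bar>t\<bar> + \<rho>)"
proof -
  define n where "n = nat \<lfloor>2 * \<rho> / d\<rfloor>"
  define \<tau> where "\<tau> j = t - \<rho> + real j * d" for j
  have n: "real n \<le> 2 * \<rho> / d"
    using \<rho> d by (simp add: n_def)
  have "G (\<bar>t\<bar> + \<rho>) \<ge> 0"
    using order_trans[OF pp_var_nonneg local[of "\<bar>t\<bar> + \<rho>"]] \<rho> by simp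
  have "pp_var \<Gamma> b {t - \<rho><..<t + \<rho>} \<le> pp_var \<Gamma> b (\<Union>j\<le>n. {\<tau> j - d..\<tau> j + d})"
    using interval_subset_UN_intervals[OF d] unfolding n_def \<tau>_def
    by (intro pp_var_mono assms(1)) auto
  also have "\<dots> \<le> (\<Sum>j\<le>n. pp_var \<Gamma> b {\<tau> j - d..\<tau> j + d})"
    by (intro pp_var_UN_le assms(1)) auto
  also have "\<dots> \<le> (\<Sum>j\<le>n. G (\<bar>t\<bar> + \<rho>))"
  proof (rule sum_mono)
    fix j assume "j \<in> {..n}"
    then have "real j * d \<le> 2 * \<rho> / d * d"
      using n d by (intro mult_right_mono) auto
    then have "real j * d \<le> 2 * \<rho>" "real j * d \<ge> 0"
      using d by auto
    then have "\<bar>\<tau> j\<bar> \<le> \<bar>t\<bar> + \<rho>"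
      unfolding \<tau>_def by linarith
    then show "pp_var \<Gamma> b {\<tau> j - d..\<tau> j + d} \<le> G (\<bar>t\<bar> + \<rho>)"
      using local[of "\<tau> j"] monoD[OF G] by (meson order_trans)
  qed
  also have "\<dots> \<le> (2 * \<rho> / d + 1) * G (\<bar>t\<bar> + \<rho>)"
    using n \<open>G (\<bar>t\<bar> + \<rho>) \<ge> 0\<close> by (simp add: mult_right_mono)
  finally show ?thesis .
qed

lemma norm_cFT_mult_fourier_kernel_le:
  assumes "cFT_pure_point \<nu> f \<Gamma> b" "test_fun g"
  shows "norm (cFT_meas \<nu> f (\<lambda>t. g t * fourier_kernel (of_real s) t)) \<le>
    (\<Sum>\<^sub>\<infinity>\<gamma>\<in>\<Gamma>. norm (b \<gamma>) * norm (g \<gamma>))"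
proof -
  let ?a = "\<lambda>\<gamma>. b \<gamma> * (g \<gamma> * fourier_kernel (of_real s) \<gamma>)"
  have norm_a: "norm (?a \<gamma>) = norm (b \<gamma>) * norm (g \<gamma>)" for \<gamma>
    by (simp add: norm_mult)
  have "cFT_meas \<nu> f (\<lambda>t. g t * fourier_kernel (of_real s) t) = (\<Sum>\<^sub>\<infinity>\<gamma>\<in>\<Gamma>. ?a \<gamma>)"
    by (intro cFT_pure_pointD(2)[OF assms(1)] test_fun_mult_smooth_fun assms(2)
        smooth_fun_fourier_kernel)
  moreover have "(\<lambda>\<gamma>. norm (?a \<gamma>)) summable_on \<Gamma>"
    unfolding norm_a
    by (rule locally_abs_summable_mult_test_fun[OF cFT_pure_pointD(1)[OF assms(1)] assms(2)])
  then have "norm (\<Sum>\<^sub>\<infinity>\<gamma>\<in>\<Gamma>. ?a \<gamma>) \<le> (\<Sum>\<^sub>\<infinity>\<gamma>\<in>\<Gamma>. norm (?a \<gamma>))"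
    by (rule norm_infsum_bound)
  ultimately show ?thesis
    by (simp only: norm_a)
qed

section \<open>Translation boundedness\<close>

locale strip_measure =
  fixes \<nu> :: "complex measure" and f :: "complex \<Rightarrow> complex" and H :: real
  assumes sets_borel: "sets \<nu> = sets borel"
    and density_measurable: "f \<in> borel_measurable \<nu>"
    and AE_density_unit: "AE z in \<nu>. norm (f z) = 1"
    and AE_in_strip: "AE z in \<nu>. z \<in> strip H"

lemma strip_measureI:
  assumes "sets \<nu> = sets borel" "f \<in> borel_measurable \<nu>" "AE z in \<nu>. norm (f z) = 1"
    and "emeasure \<nu> (- strip H) = 0"
  shows "strip_measure \<nu> f H"
proof
  have "strip H \<in> sets \<nu>"
    unfolding assms(1) strip_def by measurable
  then show "AE z in \<nu>. z \<in> strip H"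
    using assms(1,4) by (intro AE_I'[of "- strip H"] null_setsI) auto
qed (use assms in auto)

lemma (in strip_measure) integrable_cfourier:
  assumes V: "window_majorant \<nu> L q V" and g: "test_fun g"
  shows "integrable \<nu> (\<lambda>z. cfourier g (z - of_real s) * f z)"
proof -
  obtain C where C: "C \<ge> 0"
    "\<And>z. z \<in> strip H \<Longrightarrow> norm (cfourier g z) \<le> C * weight L (q + 2) (Re z)"
    using g window_majorantD(1)[OF V] by (meson cfourier_decay)
  show ?thesis
  proof (rule Bochner_Integration.integrable_bound)
    show "integrable \<nu> (\<lambda>z. C * weight L (q + 2) (Re z - s))"
      by (intro integrable_mult_right integrable_weight[OF sets_borel V])
    have "(\<lambda>z. cfourier g (z - of_real s)) \<in> borel_measurable borel"
      by (rule measurable_compose[OF _ cfourier_borel_measurable[OF g]]) measurable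
    then show "(\<lambda>z. cfourier g (z - of_real s) * f z) \<in> borel_measurable \<nu>"
      using density_measurable unfolding measurable_cong_sets[OF sets_borel refl, symmetric]
      by (rule borel_measurable_times)
    show "AE z in \<nu>. norm (cfourier g (z - of_real s) * f z) \<le>
        norm (C * weight L (q + 2) (Re z - s))"
      using AE_density_unit AE_in_strip
    proof eventually_elim
      case (elim z)
      then show ?case
        using C(2)[of "z - of_real s"] by (simp add: norm_mult strip_def)
    qed
  qed
qed

lemma measure_le_norm_LINT:
  fixes w :: "'a \<Rightarrow> real" and F :: "'a \<Rightarrow> complex"
  assumes S: "S \<in> sets M" "emeasure M S < \<infinity>" and w: "integrable M w" and F: "integrable M F"
    and le: "AE z in M. indicator S z - \<epsilon> * w z \<le> Re (F z)"
  shows "measure M S \<le> norm (LINT z|M. F z) + \<epsilon> * (LINT z|M. w z)"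
proof -
  have "measure M S - \<epsilon> * (LINT z|M. w z) = (LINT z|M. indicator S z - \<epsilon> * w z)"
    using S w by simp
  also have "\<dots> \<le> (LINT z|M. Re (F z))"
    using S w F le by (intro integral_mono_AE) auto
  also have "\<dots> \<le> norm (LINT z|M. F z)"
    using F by (simp only: integral_Re complex_Re_le_cmod)
  finally show ?thesis by simp
qed

lemma (in strip_measure) window_mass_improvement:
  assumes f_1: "AE z in \<nu>. f z = 1" and pp: "cFT_pure_point \<nu> f \<Gamma> b"
    and V: "window_majorant \<nu> L q V" and g: "test_fun g" and \<epsilon>: "\<epsilon> \<ge> 0"
    and low: "\<And>z. z \<in> strip H \<Longrightarrow>
      indicator (window L 0) z - \<epsilon> * weight L (q + 2) (Re z) \<le> Re (cfourier g z)"
  shows "emeasure \<nu> (window L s) \<le>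
    ennreal ((\<Sum>\<^sub>\<infinity>\<gamma>\<in>\<Gamma>. norm (b \<gamma>) * norm (g \<gamma>)) + \<epsilon> * (pi\<^sup>2 / 3 * V s))"
proof -
  let ?w = "\<lambda>z. weight L (q + 2) (Re z - s)"
  let ?F = "\<lambda>z. cfourier g (z - of_real s) * f z"
  have window: "window L s \<in> sets \<nu>" "emeasure \<nu> (window L s) < \<infinity>"
    using window_majorantD(4)[OF V, of s]
    by (auto simp: sets_borel window_borel intro: le_less_trans)
  have "AE z in \<nu>. indicator (window L s) z - \<epsilon> * ?w z \<le> Re (?F z)"
    using f_1 AE_in_strip
  proof eventually_elim
    case (elim z)
    then show ?case
      using low[of "z - of_real s"] by (simp add: strip_def window_def indicator_def)
  qed
  then have "measure \<nu> (window L s) \<le> norm (LINT z|\<nu>. ?F z) + \<epsilon> * (LINT z|\<nu>. ?w z)"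
    by (intro measure_le_norm_LINT window integrable_weight[OF sets_borel V]
        integrable_cfourier[OF V g])
  also have "(LINT z|\<nu>. ?F z) = cFT_meas \<nu> f (\<lambda>t. g t * fourier_kernel (of_real (- s)) t)"
    by (simp add: cFT_meas_def cfourier_mult_fourier_kernel)
  also have "norm \<dots> \<le> (\<Sum>\<^sub>\<infinity>\<gamma>\<in>\<Gamma>. norm (b \<gamma>) * norm (g \<gamma>))"
    by (rule norm_cFT_mult_fourier_kernel_le[OF pp g])
  also have "\<epsilon> * (LINT z|\<nu>. ?w z) \<le> \<epsilon> * (pi\<^sup>2 / 3 * V s)"
    using LINT_weight_le[OF sets_borel V] \<epsilon> by (rule mult_left_mono)
  finally show ?thesis
    using window(2) by (simp add: emeasure_eq_ennreal_measure ennreal_leI less_top)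
qed

lemma max_1_powr_le_power:
  fixes r x \<rho> :: real
  assumes "0 \<le> r" "r \<le> x" "1 \<le> x" "0 \<le> \<rho>" "\<rho> \<le> real q"
  shows "max 1 (r powr \<rho>) \<le> x ^ q"
proof -
  have "r powr \<rho> \<le> x powr \<rho>"
    using assms by (intro powr_mono2) auto
  also have "\<dots> \<le> x powr real q"
    using assms by (intro powr_mono) auto
  also have "\<dots> = x ^ q"
    using assms by (intro powr_realpow) auto
  finally show ?thesis
    using assms(3) by simp
qed

lemma (in strip_measure) window_majorant_of_polynomial_growth:
  assumes "C \<ge> 0" "\<rho> \<ge> 0" "\<rho> \<le> real q" and L: "L > 0"
    and growth: "\<And>r. r > 0 \<Longrightarrow>
      emeasure \<nu> {z \<in> strip H. \<bar>Re z\<bar> \<le> r} \<le> ennreal (C * max 1 (r powr \<rho>))"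
  shows "window_majorant \<nu> L q (\<lambda>s. C * (1 + L) ^ q * (1 + \<bar>s\<bar> / L) ^ q)"
  unfolding window_majorant_def
proof (intro conjI allI)
  show "moderate L q (\<lambda>s. C * (1 + L) ^ q * (1 + \<bar>s\<bar> / L) ^ q)"
    using moderate_affine[OF moderate_power[OF L] order_refl, of "C * (1 + L) ^ q"] assms(1) L
    by simp
  fix s
  have "emeasure \<nu> (window L s) \<le> emeasure \<nu> {z \<in> strip H. \<bar>Re z\<bar> \<le> \<bar>s\<bar> + L}"
  proof (rule emeasure_mono_AE)
    show "AE z in \<nu>. z \<in> window L s \<longrightarrow> z \<in> {z \<in> strip H. \<bar>Re z\<bar> \<le> \<bar>s\<bar> + L}"
      using AE_in_strip by eventually_elim (auto simp: window_def)
    show "{z \<in> strip H. \<bar>Re z\<bar> \<le> \<bar>s\<bar> + L} \<in> sets \<nu>"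
      unfolding sets_borel strip_def mem_Collect_eq by measurable
  qed
  also have "\<dots> \<le> ennreal (C * max 1 ((\<bar>s\<bar> + L) powr \<rho>))"
    using L by (intro growth) auto
  also have "\<dots> \<le> ennreal (C * ((1 + L) * (1 + \<bar>s\<bar> / L)) ^ q)"
  proof (intro ennreal_leI mult_left_mono max_1_powr_le_power)
    show "\<bar>s\<bar> + L \<le> (1 + L) * (1 + \<bar>s\<bar> / L)"
      using L by (simp add: field_simps)
    show "1 \<le> (1 + L) * (1 + \<bar>s\<bar> / L)"
      using L mult_mono[of 1 "1 + L" 1 "1 + \<bar>s\<bar> / L"] by simp
  qed (use assms in auto)
  finally show "emeasure \<nu> (window L s) \<le> ennreal (C * (1 + L) ^ q * (1 + \<bar>s\<bar> / L) ^ q)"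
    by (simp add: power_mult_distrib mult.assoc)
qed

lemma (in strip_measure) translation_bounded_of_positive_polynomial_growth:
  assumes H: "H > 0" and f_1: "AE z in \<nu>. f z = 1" and pp: "cFT_pure_point \<nu> f \<Gamma> b"
    and C: "C \<ge> 0" and \<rho>: "\<rho> \<ge> 0"
    and growth: "\<And>r. r > 0 \<Longrightarrow>
      emeasure \<nu> {z \<in> strip H. \<bar>Re z\<bar> \<le> r} \<le> ennreal (C * max 1 (r powr \<rho>))"
  shows "translation_bounded \<nu>"
proof -
  define q where "q = nat \<lceil>\<rho>\<rceil>"
  have q: "\<rho> \<le> real q"
    unfolding q_def by linarith
  define \<epsilon> where "\<epsilon> = 3 / (2 * pi\<^sup>2)"
  have \<epsilon>: "\<epsilon> > 0" "\<epsilon> * (pi\<^sup>2 / 3 * v) = v / 2" for v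
    by (simp_all add: \<epsilon>_def)
  obtain L g where L: "L > 0" and g: "test_fun g" and low: "\<And>z. z \<in> strip H \<Longrightarrow>
      indicator (window L 0) z - \<epsilon> * weight L (q + 2) (Re z) \<le> Re (cfourier g z)"
    using almost_positive_kernel_wide[OF H \<epsilon>(1)] by metis
  define A where "A = (\<Sum>\<^sub>\<infinity>\<gamma>\<in>\<Gamma>. norm (b \<gamma>) * norm (g \<gamma>))"
  have A: "A \<ge> 0"
    unfolding A_def by (intro infsum_nonneg) auto
  have "emeasure \<nu> (window L s) \<le> ennreal (A + W s / 2)" if "window_majorant \<nu> L q W" for W s
    using window_mass_improvement[OF f_1 pp that g less_imp_le[OF \<epsilon>(1)] low]
    by (simp only: A_def \<epsilon>(2))
  then have "emeasure \<nu> (window L s) \<le> ennreal (2 * A)" for s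
    using window_majorant_of_polynomial_growth[OF C \<rho> q L growth]
    by (intro window_mass_bounded_by_iteration[OF A])
  then show ?thesis
    unfolding translation_bounded_def using L A
    by (intro exI[of _ L] exI[of _ "2 * A"] conjI) auto
qed

lemma (in strip_measure) translation_bounded_of_strip_segments:
  assumes M: "\<And>s. emeasure \<nu> {z \<in> strip H. s \<le> Re z \<and> Re z \<le> s + 1} \<le> ennreal M"
  shows "translation_bounded \<nu>"
proof -
  have "emeasure \<nu> (window (1 / 2) s) \<le> ennreal (max 0 M)" for s
  proof -
    let ?S = "{z \<in> strip H. s - 1 / 2 \<le> Re z \<and> Re z \<le> (s - 1 / 2) + 1}"
    have "emeasure \<nu> (window (1 / 2) s) \<le> emeasure \<nu> ?S"
    proof (rule emeasure_mono_AE)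
      show "AE z in \<nu>. z \<in> window (1 / 2) s \<longrightarrow> z \<in> ?S"
        using AE_in_strip
      proof eventually_elim
        case (elim z)
        then show ?case
          unfolding window_def mem_Collect_eq by (intro impI conjI) (assumption | linarith)+
      qed
      show "?S \<in> sets \<nu>"
        unfolding sets_borel strip_def mem_Collect_eq by measurable
    qed
    also have "\<dots> \<le> ennreal (max 0 M)"
      using M by (rule order_trans) (simp add: ennreal_leI)
    finally show ?thesis .
  qed
  then show ?thesis
    unfolding translation_bounded_def
    by (intro exI[of _ "1 / 2"] exI[of _ "max 0 M"] conjI) auto
qed

section \<open>Independent frequencies\<close>

lemma lin_indep_int_subset: "lin_indep_int X \<Longrightarrow> Y \<subseteq> X \<Longrightarrow> lin_indep_int Y"
  unfolding lin_indep_int_def by (meson subset_trans)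

lemma lin_indep_int_imp_independent:
  assumes "lin_indep_int X"
  shows "Modules.module.independent (\<lambda>r. (*) (real_of_int r)) X"
proof -
  interpret Modules.module "(\<lambda>r. (*) (real_of_int r))"
    by (simp add: Modules.module.intro distrib_left mult.commute)
  show ?thesis
    unfolding independent_explicit_module
  proof (intro allI impI)
    fix F v and m :: "real \<Rightarrow> int"
    assume "finite F" "F \<subseteq> X" "(\<Sum>v\<in>F. real_of_int (m v) * v) = 0" "v \<in> F"
    then show "m v = 0"
      using assms[unfolded lin_indep_int_def, rule_format, of F m v] by simp
  qed
qed

lemma kronecker_lin_indep_int:
  assumes "finite F" "lin_indep_int F" "\<epsilon> > 0"
  shows "\<exists>s. \<forall>\<gamma>\<in>F. \<exists>h::int. \<bar>s * \<gamma> - of_int h - \<alpha> \<gamma>\<bar> < \<epsilon>"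
proof -
  obtain \<theta> :: "nat \<Rightarrow> real" where "bij_betw \<theta> {..<card F} F"
    using ex_bij_betw_nat_finite[OF assms(1)] unfolding atLeast0LessThan by blast
  then have \<theta>: "\<theta> ` {..<card F} = F" "inj_on \<theta> {..<card F}"
    by (auto simp: bij_betw_def)
  have "Modules.module.independent (\<lambda>r. (*) (real_of_int r)) (\<theta> ` {..<card F})"
    unfolding \<theta>(1) by (rule lin_indep_int_imp_independent[OF assms(2)])
  then obtain s h where sh: "\<And>i. i < card F \<Longrightarrow> \<bar>s * \<theta> i - of_int (h i) - \<alpha> (\<theta> i)\<bar> < \<epsilon>"
    using Kronecker_thm_1[OF _ \<theta>(2) assms(3), where \<alpha> = "\<lambda>i. \<alpha> (\<theta> i)"] by metis
  have "\<exists>h::int. \<bar>s * \<gamma> - of_int h - \<alpha> \<gamma>\<bar> < \<epsilon>" if "\<gamma> \<in> F" for \<gamma>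
  proof -
    have "\<gamma> \<in> \<theta> ` {..<card F}"
      using that \<theta>(1) by simp
    then show ?thesis
      using sh by blast
  qed
  then show ?thesis by blast
qed

lemma cos_ge_one_minus_abs: "cos x \<ge> 1 - \<bar>x\<bar>" for x :: real
proof -
  have "\<bar>sin (x / 2)\<bar> * \<bar>sin (x / 2)\<bar> \<le> \<bar>sin (x / 2)\<bar> * 1"
    by (intro mult_left_mono) auto
  also have "\<dots> \<le> \<bar>x / 2\<bar>"
    using abs_sin_x_le_abs_x[of "x / 2"] by simp
  finally show ?thesis
    using cos_double_sin[of "x / 2"] by (simp add: power2_eq_square)
qed

lemma Re_mult_fourier_kernel:
  "Re (c * fourier_kernel (of_real s) \<gamma>) = norm c * cos (2 * pi * (s * \<gamma> - of_int h) - Arg c)"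
proof -
  have "c * fourier_kernel (of_real s) \<gamma> =
      rcis (norm c) (Arg c) * rcis 1 (- (2 * pi * s * \<gamma>))"
    by (simp add: rcis_cmod_Arg fourier_kernel_of_real cis_rcis_eq)
  then have "Re (c * fourier_kernel (of_real s) \<gamma>) = norm c * cos (Arg c - 2 * pi * s * \<gamma>)"
    by (simp add: rcis_mult)
  also have "cos (Arg c - 2 * pi * s * \<gamma>) = cos (2 * pi * s * \<gamma> - Arg c)"
    by (metis cos_minus minus_diff_eq)
  also have "\<dots> = cos (2 * pi * (s * \<gamma> - of_int h) - Arg c)"
    by (rule conjunct2[OF iffD2[OF sin_cos_eq_iff]]) (rule exI[of _ h], simp add: algebra_simps)
  finally show ?thesis .
qed

lemma kronecker_align_phases:
  fixes c :: "real \<Rightarrow> complex"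
  assumes "finite F" "lin_indep_int F" "\<epsilon> > 0"
  obtains s where
    "\<And>\<gamma>. \<gamma> \<in> F \<Longrightarrow> (1 - \<epsilon>) * norm (c \<gamma>) \<le> Re (c \<gamma> * fourier_kernel (of_real s) \<gamma>)"
proof -
  obtain s where s:
    "\<forall>\<gamma>\<in>F. \<exists>h::int. \<bar>s * \<gamma> - of_int h - Arg (c \<gamma>) / (2 * pi)\<bar> < \<epsilon> / (2 * pi)"
    using kronecker_lin_indep_int[OF assms(1,2), of "\<epsilon> / (2 * pi)" "\<lambda>\<gamma>. Arg (c \<gamma>) / (2 * pi)"]
      assms(3) by auto
  show thesis
  proof
    fix \<gamma> assume "\<gamma> \<in> F"
    then obtain h :: int where h: "\<bar>s * \<gamma> - of_int h - Arg (c \<gamma>) / (2 * pi)\<bar> < \<epsilon> / (2 * pi)"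
      using s by blast
    let ?x = "2 * pi * (s * \<gamma> - of_int h) - Arg (c \<gamma>)"
    have "?x = 2 * pi * (s * \<gamma> - of_int h - Arg (c \<gamma>) / (2 * pi))"
      by (simp add: right_diff_distrib)
    then have "\<bar>?x\<bar> = 2 * pi * \<bar>s * \<gamma> - of_int h - Arg (c \<gamma>) / (2 * pi)\<bar>"
      by (simp add: abs_mult)
    also have "\<dots> \<le> 2 * pi * (\<epsilon> / (2 * pi))"
      using h by (intro mult_left_mono) auto
    finally have "1 - \<epsilon> \<le> cos ?x"
      using cos_ge_one_minus_abs[of ?x] by simp
    then have "(1 - \<epsilon>) * norm (c \<gamma>) \<le> cos ?x * norm (c \<gamma>)"
      by (rule mult_right_mono) simp
    then show "(1 - \<epsilon>) * norm (c \<gamma>) \<le> Re (c \<gamma> * fourier_kernel (of_real s) \<gamma>)"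
      by (simp only: Re_mult_fourier_kernel[of _ _ _ h] mult.commute[of "norm (c \<gamma>)"])
  qed
qed

lemma sum_norm_plus_Re_le:
  fixes a :: "'i \<Rightarrow> complex"
  assumes summ: "(\<lambda>i. norm (a i)) summable_on I" and F: "finite F" "F \<subseteq> I"
  shows "(\<Sum>i\<in>F. norm (a i) + Re (a i)) \<le> (\<Sum>\<^sub>\<infinity>i\<in>I. norm (a i)) + norm (\<Sum>\<^sub>\<infinity>i\<in>I. a i)"
proof -
  have a: "a summable_on I"
    using summ by (rule abs_summable_summable)
  have "(\<Sum>i\<in>F. norm (a i) + Re (a i)) \<le> (\<Sum>\<^sub>\<infinity>i\<in>I. norm (a i) + Re (a i))"
  proof (intro finite_sum_le_infsum summable_on_add summ summable_on_Re a F)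
    show "0 \<le> norm (a i) + Re (a i)" for i
      using abs_Re_le_cmod[of "a i"] by linarith
  qed
  also have "\<dots> = (\<Sum>\<^sub>\<infinity>i\<in>I. norm (a i)) + Re (\<Sum>\<^sub>\<infinity>i\<in>I. a i)"
    by (simp only: infsum_add[OF summ summable_on_Re[OF a]] infsum_Re[OF a])
  finally show ?thesis
    using complex_Re_le_cmod[of "\<Sum>\<^sub>\<infinity>i\<in>I. a i"] by linarith
qed

lemma infsum_norm_le_of_indep_frequencies:
  fixes c :: "real \<Rightarrow> complex"
  assumes indep: "lin_indep_int \<Gamma>" and summ: "(\<lambda>\<gamma>. norm (c \<gamma>)) summable_on \<Gamma>"
    and bound: "\<And>s. norm (\<Sum>\<^sub>\<infinity>\<gamma>\<in>\<Gamma>. c \<gamma> * fourier_kernel (of_real s) \<gamma>) \<le> B"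
  shows "(\<Sum>\<^sub>\<infinity>\<gamma>\<in>\<Gamma>. norm (c \<gamma>)) \<le> B"
proof -
  define T where "T = (\<Sum>\<^sub>\<infinity>\<gamma>\<in>\<Gamma>. norm (c \<gamma>))"
  have "2 * (\<Sum>\<gamma>\<in>F. norm (c \<gamma>)) \<le> T + B" if F: "finite F" "F \<subseteq> \<Gamma>" for F
  proof (rule field_le_mult_one_interval)
    fix \<theta> :: real assume "0 < \<theta>" "\<theta> < 1"
    then obtain s where s: "\<And>\<gamma>. \<gamma> \<in> F \<Longrightarrow>
        (1 - 2 * (1 - \<theta>)) * norm (c \<gamma>) \<le> Re (c \<gamma> * fourier_kernel (of_real s) \<gamma>)"
      using kronecker_align_phases[OF F(1) lin_indep_int_subset[OF indep F(2)], of "2 * (1 - \<theta>)" c]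
      by auto
    let ?a = "\<lambda>\<gamma>. c \<gamma> * fourier_kernel (of_real s) \<gamma>"
    have norm_a: "norm (?a \<gamma>) = norm (c \<gamma>)" for \<gamma>
      by (simp add: norm_mult)
    have "\<theta> * (2 * (\<Sum>\<gamma>\<in>F. norm (c \<gamma>))) = (\<Sum>\<gamma>\<in>F. 2 * \<theta> * norm (c \<gamma>))"
      by (simp add: sum_distrib_left mult_ac)
    also have "\<dots> \<le> (\<Sum>\<gamma>\<in>F. norm (?a \<gamma>) + Re (?a \<gamma>))"
      unfolding norm_a using s by (intro sum_mono) (fastforce simp: algebra_simps)
    also have "\<dots> \<le> (\<Sum>\<^sub>\<infinity>\<gamma>\<in>\<Gamma>. norm (?a \<gamma>)) + norm (infsum ?a \<Gamma>)"
      using summ by (intro sum_norm_plus_Re_le F) (simp only: norm_a)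
    also have "\<dots> \<le> T + B"
      unfolding norm_a T_def using bound by simp
    finally show "\<theta> * (2 * (\<Sum>\<gamma>\<in>F. norm (c \<gamma>))) \<le> T + B" .
  qed
  then have "(\<Sum>\<gamma>\<in>F. norm (c \<gamma>)) \<le> (T + B) / 2" if "finite F" "F \<subseteq> \<Gamma>" for F
    using that by fastforce
  then have "T \<le> (T + B) / 2"
    unfolding T_def by (intro infsum_le_finite_sums summ) auto
  then show ?thesis
    by (simp add: T_def)
qed

lemma infsum_norm_le_of_cFT_bound:
  assumes pp: "cFT_pure_point \<nu> f \<Gamma> b" and g: "test_fun g"
    and indep: "lin_indep_int {\<gamma> \<in> \<Gamma>. g \<gamma> \<noteq> 0}"
    and bound: "\<And>s. norm (cFT_meas \<nu> f (\<lambda>t. g t * fourier_kernel (of_real s) t)) \<le> B"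
  shows "(\<Sum>\<^sub>\<infinity>\<gamma>\<in>\<Gamma>. norm (b \<gamma>) * norm (g \<gamma>)) \<le> B"
proof -
  let ?S = "{\<gamma> \<in> \<Gamma>. g \<gamma> \<noteq> 0}"
  have "(\<Sum>\<^sub>\<infinity>\<gamma>\<in>?S. norm (b \<gamma> * g \<gamma>)) \<le> B"
  proof (rule infsum_norm_le_of_indep_frequencies[OF indep])
    have "(\<lambda>\<gamma>. norm (b \<gamma>) * norm (g \<gamma>)) summable_on ?S"
      using locally_abs_summable_mult_test_fun[OF cFT_pure_pointD(1)[OF pp] g]
      by (rule summable_on_subset_banach) auto
    then show "(\<lambda>\<gamma>. norm (b \<gamma> * g \<gamma>)) summable_on ?S"
      by (simp add: norm_mult)
    fix s
    have "(\<Sum>\<^sub>\<infinity>\<gamma>\<in>?S. b \<gamma> * g \<gamma> * fourier_kernel (of_real s) \<gamma>) =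
        (\<Sum>\<^sub>\<infinity>\<gamma>\<in>\<Gamma>. b \<gamma> * (g \<gamma> * fourier_kernel (of_real s) \<gamma>))"
      by (intro infsum_cong_neutral) (auto simp: mult.assoc)
    also have "\<dots> = cFT_meas \<nu> f (\<lambda>t. g t * fourier_kernel (of_real s) t)"
      by (intro cFT_pure_pointD(2)[OF pp, symmetric] test_fun_mult_smooth_fun g
          smooth_fun_fourier_kernel)
    finally show "norm (\<Sum>\<^sub>\<infinity>\<gamma>\<in>?S. b \<gamma> * g \<gamma> * fourier_kernel (of_real s) \<gamma>) \<le> B"
      using bound by simp
  qed
  also have "(\<Sum>\<^sub>\<infinity>\<gamma>\<in>?S. norm (b \<gamma> * g \<gamma>)) = (\<Sum>\<^sub>\<infinity>\<gamma>\<in>\<Gamma>. norm (b \<gamma>) * norm (g \<gamma>))"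
    by (intro infsum_cong_neutral) (auto simp: norm_mult)
  finally show ?thesis .
qed

section \<open>Growth of the variation\<close>

lemma (in strip_measure) norm_cFT_translate_le:
  assumes "translation_bounded \<nu>" and g: "test_fun g"
  obtains C where
    "\<And>t s. norm (cFT_meas \<nu> f (\<lambda>x. g (x - t) * fourier_kernel (of_real s) x)) \<le>
      C * exp (2 * pi * H * \<bar>t\<bar>)"
proof -
  obtain L M where L: "L > 0" and M: "window_majorant \<nu> L 0 (\<lambda>_. M)"
    using assms(1) moderate_const unfolding translation_bounded_def window_majorant_def by blast
  obtain C where C: "C \<ge> 0"
    "\<And>z. z \<in> strip H \<Longrightarrow> norm (cfourier g z) \<le> C * weight L (0 + 2) (Re z)"
    using g L by (meson cfourier_decay)
  show thesis
  proof
    fix t s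
    let ?E = "exp (2 * pi * H * \<bar>t\<bar>)"
    let ?F = "\<lambda>z. fourier_kernel (of_real s + z) t * cfourier g (of_real s + z) * f z"
    have "AE z in \<nu>. norm (?F z) \<le> ?E * C * weight L (0 + 2) (Re z - (- s))"
      using AE_density_unit AE_in_strip
    proof eventually_elim
      case (elim z)
      then have "of_real s + z \<in> strip H"
        by (simp add: strip_def)
      then have "norm (fourier_kernel (of_real s + z) t) * norm (cfourier g (of_real s + z)) \<le>
          ?E * (C * weight L (0 + 2) (Re (of_real s + z)))"
        by (intro mult_mono norm_fourier_kernel_le C(2)) auto
      then show ?case
        using elim(1) by (simp add: norm_mult mult.assoc add.commute)
    qed
    then have "norm (LINT z|\<nu>. ?F z) \<le> ?E * C * (pi\<^sup>2 / 3 * M)"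
      using C(1) by (intro norm_LINT_le_weight[OF sets_borel M, where s = "- s"]) simp_all
    also have "(LINT z|\<nu>. ?F z) = cFT_meas \<nu> f (\<lambda>x. g (x - t) * fourier_kernel (of_real s) x)"
      by (simp only: cFT_meas_def cfourier_mult_fourier_kernel cfourier_translate)
    finally show "norm (cFT_meas \<nu> f (\<lambda>x. g (x - t) * fourier_kernel (of_real s) x)) \<le>
        C * (pi\<^sup>2 / 3 * M) * ?E"
      by (simp only: mult_ac)
  qed
qed

lemma pp_var_le_infsum_bump:
  assumes "locally_abs_summable b \<Gamma>" and r: "r > 0"
  shows "pp_var \<Gamma> b {t - r / 2..t + r / 2} \<le>
    exp (4 / r) * (\<Sum>\<^sub>\<infinity>\<gamma>\<in>\<Gamma>. norm (b \<gamma>) * norm (complex_of_real (bump r (\<gamma> - t))))"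
proof -
  have "test_fun (\<lambda>x. complex_of_real (bump r (x - t)))"
    by (rule test_fun_translate[OF test_fun_bump])
  then have summ: "(\<lambda>\<gamma>. norm (b \<gamma>) * norm (complex_of_real (bump r (\<gamma> - t)))) summable_on \<Gamma>"
    using assms(1) by (intro locally_abs_summable_mult_test_fun)
  have "pp_var \<Gamma> b {t - r / 2..t + r / 2} \<le>
      (\<Sum>\<^sub>\<infinity>\<gamma>\<in>\<Gamma>. exp (4 / r) * (norm (b \<gamma>) * norm (complex_of_real (bump r (\<gamma> - t)))))"
    unfolding pp_var_def
  proof (rule infsum_mono_neutral)
    show "(\<lambda>\<gamma>. norm (b \<gamma>)) summable_on \<Gamma> \<inter> {t - r / 2..t + r / 2}"
      using assms(1) by (intro locally_abs_summable_bounded) auto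
    fix \<gamma> assume "\<gamma> \<in> \<Gamma> \<inter> {t - r / 2..t + r / 2} \<inter> \<Gamma>"
    then have "\<bar>\<gamma> - t\<bar> \<le> r / 2"
      by (simp only: Int_iff atLeastAtMost_iff) linarith
    then have "exp (4 / r) * exp (- 4 / r) \<le> exp (4 / r) * bump r (\<gamma> - t)"
      using r by (intro mult_left_mono bump_ge) auto
    then have "1 \<le> exp (4 / r) * bump r (\<gamma> - t)"
      by (simp flip: exp_add)
    then have "norm (b \<gamma>) * 1 \<le> norm (b \<gamma>) * (exp (4 / r) * bump r (\<gamma> - t))"
      by (intro mult_left_mono) auto
    then show "norm (b \<gamma>) \<le> exp (4 / r) * (norm (b \<gamma>) * norm (complex_of_real (bump r (\<gamma> - t))))"
      by (simp add: bump_nonneg mult_ac)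
  qed (use summ in \<open>auto intro: summable_on_cmult_right\<close>)
  then show ?thesis
    by (simp only: infsum_cmult_right')
qed

lemma (in strip_measure) local_variation_growth:
  assumes bounded: "translation_bounded \<nu>" and pp: "cFT_pure_point \<nu> f \<Gamma> b"
    and \<eta>: "\<eta> > 0" "\<And>t. lin_indep_int (\<Gamma> \<inter> {t - \<eta><..<t + \<eta>})"
  obtains C where "\<And>t. pp_var \<Gamma> b {t - \<eta> / 2..t + \<eta> / 2} \<le> C * exp (2 * pi * H * \<bar>t\<bar>)"
proof -
  define \<phi> where "\<phi> t x = complex_of_real (bump \<eta> (x - t))" for t x
  obtain C where C:
    "\<And>t s. norm (cFT_meas \<nu> f (\<lambda>x. \<phi> t x * fourier_kernel (of_real s) x)) \<le>
      C * exp (2 * pi * H * \<bar>t\<bar>)"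
    using norm_cFT_translate_le[OF bounded test_fun_bump[of \<eta>]] unfolding \<phi>_def by blast
  show thesis
  proof
    fix t
    have "test_fun (\<phi> t)"
      unfolding \<phi>_def[abs_def] by (rule test_fun_translate[OF test_fun_bump])
    moreover have "t - \<eta> < \<gamma> \<and> \<gamma> < t + \<eta>" if "bump \<eta> (\<gamma> - t) \<noteq> 0" for \<gamma>
      using that bump_eq_0[of \<eta> "\<gamma> - t"] by linarith
    then have "{\<gamma> \<in> \<Gamma>. \<phi> t \<gamma> \<noteq> 0} \<subseteq> \<Gamma> \<inter> {t - \<eta><..<t + \<eta>}"
      by (auto simp: \<phi>_def)
    ultimately have "(\<Sum>\<^sub>\<infinity>\<gamma>\<in>\<Gamma>. norm (b \<gamma>) * norm (\<phi> t \<gamma>)) \<le> C * exp (2 * pi * H * \<bar>t\<bar>)"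
      by (intro infsum_norm_le_of_cFT_bound[OF pp] lin_indep_int_subset[OF \<eta>(2)[of t]] C)
    then have "exp (4 / \<eta>) * (\<Sum>\<^sub>\<infinity>\<gamma>\<in>\<Gamma>. norm (b \<gamma>) * norm (\<phi> t \<gamma>)) \<le>
        exp (4 / \<eta>) * (C * exp (2 * pi * H * \<bar>t\<bar>))"
      by (intro mult_left_mono) auto
    then show "pp_var \<Gamma> b {t - \<eta> / 2..t + \<eta> / 2} \<le> exp (4 / \<eta>) * C * exp (2 * pi * H * \<bar>t\<bar>)"
      unfolding mult.assoc \<phi>_def
      using pp_var_le_infsum_bump[OF cFT_pure_pointD(1)[OF pp] \<eta>(1)] by (rule order_trans[rotated])
  qed
qed

lemma ln_le_ln_plus:
  fixes x y P :: real
  assumes "0 \<le> y" "y \<le> P * exp x" "1 \<le> P" "0 \<le> x"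
  shows "ln y \<le> ln P + x"
proof (cases "y = 0")
  case True
  \<comment> \<open>\<open>ln 0 = 0\<close>, so this case needs \<open>P \<ge> 1\<close> and \<open>x \<ge> 0\<close>\<close>
  then show ?thesis using assms by simp
next
  case False
  then have "ln y \<le> ln (P * exp x)"
    using assms by (intro ln_mono) auto
  also have "\<dots> = ln P + x"
    using assms by (simp add: ln_mult)
  finally show ?thesis .
qed

lemma Limsup_ln_div_le:
  fixes F :: "real \<Rightarrow> real"
  assumes a: "a \<ge> 0" and p: "p \<ge> 0" and q: "q \<ge> 1"
    and F_nonneg: "\<And>r. F r \<ge> 0"
    and F_le: "\<And>r. r \<ge> 0 \<Longrightarrow> F r \<le> (p * r + q) * exp (a * r)"
  shows "Limsup at_top (\<lambda>r. ereal (ln (F r) / r)) \<le> ereal a"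
proof -
  let ?G = "\<lambda>r. ln (p * r + q) / r + a"
  have "\<forall>\<^sub>F r in at_top. ereal (ln (F r) / r) \<le> ereal (?G r)"
    using eventually_gt_at_top[of 0]
  proof eventually_elim
    case (elim r)
    then have "ln (F r) \<le> ln (p * r + q) + a * r"
      using a p q by (intro ln_le_ln_plus F_nonneg F_le) (auto simp: add_increasing)
    then have "ln (F r) / r \<le> (ln (p * r + q) + a * r) / r"
      using elim by (intro divide_right_mono) auto
    also have "\<dots> = ?G r"
      using elim by (simp add: add_divide_distrib)
    finally show ?case by simp
  qed
  then have "Limsup at_top (\<lambda>r. ereal (ln (F r) / r)) \<le> Limsup at_top (\<lambda>r. ereal (?G r))"
    by (rule Limsup_mono)
  also have "((\<lambda>r. ln (p * r + q) / r) \<longlongrightarrow> 0) at_top"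
    using p q by (cases "p = 0") real_asymp+
  then have "((\<lambda>r. ereal (?G r)) \<longlongrightarrow> ereal (0 + a)) at_top"
    by (intro tendsto_intros)
  then have "Limsup at_top (\<lambda>r. ereal (?G r)) = ereal a"
    by (intro lim_imp_Limsup) auto
  finally show ?thesis .
qed

lemma pp_var_interval_exp_le:
  assumes "locally_abs_summable b \<Gamma>" "d > 0" "a \<ge> 0"
    and local: "\<And>t. pp_var \<Gamma> b {t - d..t + d} \<le> C * exp (a * \<bar>t\<bar>)" and "\<rho> \<ge> 0"
  shows "pp_var \<Gamma> b {t - \<rho><..<t + \<rho>} \<le> (2 * \<rho> / d + 1) * C * exp (a * (\<bar>t\<bar> + \<rho>))"
proof -
  have "C \<ge> 0"
    using order_trans[OF pp_var_nonneg local[of 0]] by simp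
  then have "mono (\<lambda>x. C * exp (a * x))"
    using assms(3) by (intro monoI mult_left_mono) (auto intro: mult_left_mono)
  from pp_var_interval_le[OF assms(1,2,5) this local] show ?thesis
    by (simp add: mult.assoc)
qed

lemma pp_var_interval_bigo:
  assumes "locally_abs_summable b \<Gamma>" "d > 0" "a \<ge> 0"
    and "\<And>t. pp_var \<Gamma> b {t - d..t + d} \<le> C * exp (a * \<bar>t\<bar>)" and "\<rho> \<ge> 0"
  shows "(\<lambda>t. pp_var \<Gamma> b {t - \<rho><..<t + \<rho>}) \<in> O[F](\<lambda>t. exp (a * \<bar>t\<bar>))"
proof (rule bigoI, rule always_eventually, rule allI)
  fix t
  show "norm (pp_var \<Gamma> b {t - \<rho><..<t + \<rho>}) \<le>
      (2 * \<rho> / d + 1) * C * exp (a * \<rho>) * norm (exp (a * \<bar>t\<bar>))"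
    using pp_var_interval_exp_le[OF assms, of t] pp_var_nonneg[of \<Gamma> b]
    by (simp add: distrib_left exp_add mult_ac)
qed

lemma Limsup_ln_pp_var_le:
  assumes "locally_abs_summable b \<Gamma>" "d > 0" "a \<ge> 0"
    and local: "\<And>t. pp_var \<Gamma> b {t - d..t + d} \<le> C * exp (a * \<bar>t\<bar>)"
  shows "Limsup at_top (\<lambda>r. ereal (ln (pp_var \<Gamma> b {-r<..<r}) / r)) \<le> ereal a"
proof -
  have C: "C \<ge> 0"
    using order_trans[OF pp_var_nonneg local[of 0]] by simp
  show ?thesis
  proof (rule Limsup_ln_div_le)
    fix r :: real assume r: "r \<ge> 0"
    have "pp_var \<Gamma> b {-r<..<r} \<le> (2 * r / d + 1) * C * exp (a * r)"
      using pp_var_interval_exp_le[OF assms r, of 0] r by simp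
    also have "\<dots> \<le> (2 * r / d + 1) * (C + 1) * exp (a * r)"
      using r assms(2) by (intro mult_right_mono mult_left_mono) auto
    finally show "pp_var \<Gamma> b {-r<..<r} \<le> (2 * (C + 1) / d * r + (C + 1)) * exp (a * r)"
      by (simp add: algebra_simps add_divide_distrib)
  qed (use assms(2,3) C in \<open>auto intro: pp_var_nonneg\<close>)
qed

theorem theorem3:
  fixes H :: real and \<nu> :: "complex measure" and f :: "complex \<Rightarrow> complex"
    and \<Gamma> :: "real set" and b :: "real \<Rightarrow> complex"
  assumes H: "H > 0"
    and sets_nu: "sets \<nu> = sets borel"
    and f_meas: "f \<in> borel_measurable \<nu>"
    and f_unit: "AE z in \<nu>. norm (f z) = 1"
    and supp: "emeasure \<nu> (- strip H) = 0"
    and cases: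
      "(\<exists>C0 \<rho>. C0 > 0 \<and> \<rho> > 0 \<and> (AE z in \<nu>. f z = 1) \<and>
          (\<forall>r>0. emeasure \<nu> {z \<in> strip H. \<bar>Re z\<bar> \<le> r} \<le> ennreal (C0 * max 1 (r powr \<rho>))))
       \<or> (\<exists>M. \<forall>s. emeasure \<nu> {z \<in> strip H. s \<le> Re z \<and> Re z \<le> s + 1} \<le> ennreal M)"
    and pp: "cFT_pure_point \<nu> f \<Gamma> b"
    and indep: "\<exists>\<eta>>0. \<forall>t. lin_indep_int (\<Gamma> \<inter> {t - \<eta><..<t + \<eta>})"
  shows "(\<lambda>t. pp_var \<Gamma> b {t - 1<..<t + 1}) \<in> O[at_infinity](\<lambda>t. exp (2 * pi * H * \<bar>t\<bar>)) \<and>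
         Limsup at_top (\<lambda>r. ereal (ln (pp_var \<Gamma> b {-r<..<r}) / r)) \<le> ereal (2 * pi * H)"
proof -
  interpret strip_measure \<nu> f H
    using sets_nu f_meas f_unit supp by (rule strip_measureI)
  have bounded: "translation_bounded \<nu>"
    using cases
  proof (elim disjE exE conjE)
    fix C0 \<rho> :: real
    assume "C0 > 0" "\<rho> > 0" "AE z in \<nu>. f z = 1"
      and "\<forall>r>0. emeasure \<nu> {z \<in> strip H. \<bar>Re z\<bar> \<le> r} \<le> ennreal (C0 * max 1 (r powr \<rho>))"
    then show ?thesis
      using translation_bounded_of_positive_polynomial_growth[OF H _ pp, of C0 \<rho>] by simp
  qed (blast intro: translation_bounded_of_strip_segments)
  obtain \<eta> where \<eta>: "\<eta> > 0" "\<And>t. lin_indep_int (\<Gamma> \<inter> {t - \<eta><..<t + \<eta>})"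
    using indep by blast
  obtain C where C: "\<And>t. pp_var \<Gamma> b {t - \<eta> / 2..t + \<eta> / 2} \<le> C * exp (2 * pi * H * \<bar>t\<bar>)"
    using local_variation_growth[OF bounded pp \<eta>] by blast
  show ?thesis
    using pp_var_interval_bigo[OF cFT_pure_pointD(1)[OF pp] _ _ C]
      Limsup_ln_pp_var_le[OF cFT_pure_pointD(1)[OF pp] _ _ C] \<eta>(1) H by simp
qed

end
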